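(* Let $\Gamma=\{r,b\}$ and let $R^{rb}\subset R^r,R^b\subset R$ be a compatible Frobenius square. Let $P=\mathrm{Ind}^{\emptyset}_{b}\,\mathrm{Ind}^{b}_{rb}=R\otimes_{R^b}R^b$ and $Q=\mathrm{Ind}^{\emptyset}_{r}\,\mathrm{Ind}^{r}_{rb}=R\otimes_{R^r}R^r$, two $(R,R^{rb})$-bimodules, and let $\phi\colon P\to Q$, $f\otimes 1\mapsto f\otimes 1$, be the induction isomorphism. Then $\phi$ is cyclic with respect to the biadjunctions specified in the context, i.e. its left mate and its right mate (the two 180 degree rotations of $\phi$) are equal as maps $Q^\vee\to P^\vee$. Moreover, this 180 degree rotation of $\phi$ is the restriction isomorphism $Q^\vee=R^r\otimes_{R^r}R\to P^\vee=R^b\otimes_{R^b}R$, $1\otimes f\mapsto 1\otimes f$.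
   Context: All rings are commutative algebras over a field $\Bbbk$. A Frobenius extension is an extension $\iota\colon A\hookrightarrow B$ with $B$ free and finitely generated as an $A$-module, together with an $A$-linear map $\partial=\partial^B_A\colon B\to A$ (the trace) for which there exist $A$-bases $\{x_\alpha\},\{y_\alpha\}$ of $B$ with $\partial(x_\alpha y_\beta)=\delta_{\alpha\beta}$ (dual bases). The comultiplication $\Delta^B_A\colon B\to B\otimes_A B$ is the $B$-bimodule map with $1\mapsto\sum_\alpha x_\alpha\otimes y_\alpha$, and $m\colon B\otimes_A B\to B$ is multiplication. A compatible Frobenius square with $\Gamma=\{r,b\}$ consists of rings $R=R^\emptyset\supset R^r,R^b\supset R^{rb}$ with traces $\partial_r\colon R\to R^r$, $\partial_b\colon R\to R^b$, $\partial^r_{rb}\colon R^r\to R^{rb}$, $\partial^b_{rb}\colon R^b\to R^{rb}$ making each of the four inclusions a Frobenius extension, and with $\partial^r_{rb}\partial_r=\partial^b_{rb}\partial_b$. For a Frobenius extension $A\subset B$, the induction bimodule is $\mathrm{Ind}={}_BB_A$ and the restriction bimodule is $\mathrm{Res}={}_AB_B$. Composition is tensor product. They are biadjoint via: $\iota\colon A\to \mathrm{Res}\circ\mathrm{Ind}={}_AB_A$ (unit) and $m\colon \mathrm{Ind}\circ\mathrm{Res}=B\otimes_AB\to B$ (counit), exhibiting $\mathrm{Ind}\dashv\mathrm{Res}$; and $\Delta^B_A\colon B\to \mathrm{Ind}\circ\mathrm{Res}$ (unit) and $\partial\colon\mathrm{Res}\circ\mathrm{Ind}\to A$ (counit), exhibiting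 $\mathrm{Res}\dashv\mathrm{Ind}$. Composites of inductions are given the composite biadjunctions; thus $P^\vee=\mathrm{Res}^b_{rb}\mathrm{Res}^\emptyset_b=R^b\otimes_{R^b}R$ and $Q^\vee=\mathrm{Res}^r_{rb}\mathrm{Res}^\emptyset_r=R^r\otimes_{R^r}R$ are the specified biadjoints of $P$ and $Q$. For $\phi\colon P\to Q$, one mate is the composite $Q^\vee\to P^\vee PQ^\vee\to P^\vee QQ^\vee\to P^\vee$ (using the unit $1\to P^\vee P$ of $P\dashv P^\vee$, then $\phi$, then the counit $QQ^\vee\to1$ of $Q\dashv Q^\vee$); the other is $Q^\vee\to Q^\vee PP^\vee\to Q^\vee QP^\vee\to P^\vee$ (using the unit $1\to PP^\vee$ of $P^\vee\dashv P$, then $\phi$, then the counit $Q^\vee Q\to 1$ of $Q^\vee\dashv Q$). These are the two 180 degree rotations of $\phi$ in string-diagram notation. *)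

theory Defs
  imports "HOL-Algebra.Module" "HOL-Algebra.Free_Abelian_Groups"
begin

section \<open>Frobenius extensions\<close>

text \<open>
  All rings of an extension are records over one element type; an extension \<open>A \<subseteq> B\<close> means that
  \<open>A\<close> is \<open>B\<close> with a smaller carrier, so that all operations of \<open>A\<close> (including the unit and the
  \<open>K\<close>-action) are those of \<open>B\<close>.
\<close>

definition algebra_extension ::
    "('k, 'c) ring_scheme \<Rightarrow> ('k, 'a, 'd) module_scheme \<Rightarrow> ('k, 'a, 'd) module_scheme \<Rightarrow> bool"
  where "algebra_extension K A B \<longleftrightarrow>
    field K \<and> algebra K A \<and> algebra K B \<and> carrier A \<subseteq> carrier B \<and> A = B\<lparr>carrier := carrier A\<rparr>"

definition finite_basis ::
    "('a, 'c) ring_scheme \<Rightarrow> ('a, 'd) ring_scheme \<Rightarrow> nat \<Rightarrow> (nat \<Rightarrow> 'a) \<Rightarrow> bool"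
  where "finite_basis A B n x \<longleftrightarrow>
    x \<in> {..<n} \<rightarrow> carrier B \<and>
    (\<forall>b \<in> carrier B. \<exists>a \<in> {..<n} \<rightarrow> carrier A. b = (\<Oplus>\<^bsub>B\<^esub> i \<in> {..<n}. a i \<otimes>\<^bsub>B\<^esub> x i)) \<and>
    (\<forall>a \<in> {..<n} \<rightarrow> carrier A.
      (\<Oplus>\<^bsub>B\<^esub> i \<in> {..<n}. a i \<otimes>\<^bsub>B\<^esub> x i) = \<zero>\<^bsub>B\<^esub> \<longrightarrow> (\<forall>i<n. a i = \<zero>\<^bsub>A\<^esub>))"

definition dual_bases ::
    "('a, 'c) ring_scheme \<Rightarrow> ('a, 'd) ring_scheme \<Rightarrow> ('a \<Rightarrow> 'a) \<Rightarrow> nat \<Rightarrow> (nat \<Rightarrow> 'a) \<Rightarrow> (nat \<Rightarrow> 'a) \<Rightarrow> bool"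
  where "dual_bases A B \<delta> n x y \<longleftrightarrow>
    finite_basis A B n x \<and> finite_basis A B n y \<and>
    (\<forall>i<n. \<forall>j<n. \<delta> (x i \<otimes>\<^bsub>B\<^esub> y j) = (if i = j then \<one>\<^bsub>A\<^esub> else \<zero>\<^bsub>A\<^esub>))"

definition linear_over ::
    "('a, 'c) ring_scheme \<Rightarrow> ('a, 'd) ring_scheme \<Rightarrow> ('a \<Rightarrow> 'a) \<Rightarrow> bool"
  where "linear_over A B \<delta> \<longleftrightarrow>
    \<delta> \<in> carrier B \<rightarrow> carrier A \<and>
    (\<forall>b \<in> carrier B. \<forall>b' \<in> carrier B. \<delta> (b \<oplus>\<^bsub>B\<^esub> b') = \<delta> b \<oplus>\<^bsub>A\<^esub> \<delta> b') \<and>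
    (\<forall>a \<in> carrier A. \<forall>b \<in> carrier B. \<delta> (a \<otimes>\<^bsub>B\<^esub> b) = a \<otimes>\<^bsub>A\<^esub> \<delta> b)"

definition frobenius_extension ::
    "('k, 'c) ring_scheme \<Rightarrow> ('k, 'a, 'd) module_scheme \<Rightarrow> ('k, 'a, 'd) module_scheme \<Rightarrow> ('a \<Rightarrow> 'a) \<Rightarrow> bool"
  where "frobenius_extension K A B \<delta> \<longleftrightarrow>
    algebra_extension K A B \<and> linear_over A B \<delta> \<and> (\<exists>n x y. dual_bases A B \<delta> n x y)"

definition compatible_frobenius_square ::
    "('k, 'c) ring_scheme \<Rightarrow> ('k, 'a, 'd) module_scheme \<Rightarrow> ('k, 'a, 'd) module_scheme \<Rightarrow>
     ('k, 'a, 'd) module_scheme \<Rightarrow> ('k, 'a, 'd) module_scheme \<Rightarrow>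
     ('a \<Rightarrow> 'a) \<Rightarrow> ('a \<Rightarrow> 'a) \<Rightarrow> ('a \<Rightarrow> 'a) \<Rightarrow> ('a \<Rightarrow> 'a) \<Rightarrow> bool"
  where "compatible_frobenius_square K R Rr Rb Rrb \<delta>r \<delta>b \<delta>r_rb \<delta>b_rb \<longleftrightarrow>
    frobenius_extension K Rr R \<delta>r \<and> frobenius_extension K Rb R \<delta>b \<and>
    frobenius_extension K Rrb Rr \<delta>r_rb \<and> frobenius_extension K Rrb Rb \<delta>b_rb \<and>
    (\<forall>f \<in> carrier R. \<delta>r_rb (\<delta>r f) = \<delta>b_rb (\<delta>b f))"


section \<open>Bimodules and their tensor product\<close>

text \<open>
  As for the library's \<open>module\<close>, the fields \<open>mult\<close> and \<open>one\<close> inherited from \<open>ring\<close> carry no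
  meaning for a bimodule. The acting rings are not part of the record: they are passed to the
  operations that need them, so restricting an action to a subring does not change the record.
\<close>

record ('a, 'b, 'm) bimodule = "('a, 'm) module" +
  ract :: "['m, 'b] \<Rightarrow> 'm"

definition bimodule_hom ::
    "('a, 'c) ring_scheme \<Rightarrow> ('b, 'd) ring_scheme \<Rightarrow> ('a, 'b, 'm) bimodule \<Rightarrow> ('a, 'b, 'n) bimodule \<Rightarrow>
     ('m \<Rightarrow> 'n) set"
  where "bimodule_hom A B M N = {h \<in> carrier M \<rightarrow> carrier N.
    (\<forall>x \<in> carrier M. \<forall>y \<in> carrier M. h (x \<oplus>\<^bsub>M\<^esub> y) = h x \<oplus>\<^bsub>N\<^esub> h y) \<and>
    (\<forall>a \<in> carrier A. \<forall>x \<in> carrier M. h (a \<odot>\<^bsub>M\<^esub> x) = a \<odot>\<^bsub>N\<^esub> h x) \<and>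
    (\<forall>x \<in> carrier M. \<forall>b \<in> carrier B. h (ract M x b) = ract N (h x) b)}"

definition bimodule_iso ::
    "('a, 'c) ring_scheme \<Rightarrow> ('b, 'd) ring_scheme \<Rightarrow> ('a, 'b, 'm) bimodule \<Rightarrow> ('a, 'b, 'n) bimodule \<Rightarrow>
     ('m \<Rightarrow> 'n) set"
  where "bimodule_iso A B M N = {h \<in> bimodule_hom A B M N. bij_betw h (carrier M) (carrier N)}"

text \<open>
  \<open>M \<otimes>\<^sub>A N\<close> is the quotient of the free abelian group on \<open>M \<times> N\<close> by the subgroup generated by the
  biadditivity and \<open>A\<close>-balancing relations; its elements are cosets.
\<close>

type_synonym ('m, 'n) tensor = "(('m \<times> 'n) \<Rightarrow>\<^sub>0 int) set"

definition tensor_relators ::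
    "('a, 'c) ring_scheme \<Rightarrow> ('l, 'a, 'm) bimodule \<Rightarrow> ('a, 'r, 'n) bimodule \<Rightarrow> ('m \<times> 'n \<Rightarrow>\<^sub>0 int) set"
  where "tensor_relators A M N =
    {frag_of (x \<oplus>\<^bsub>M\<^esub> x', y) - frag_of (x, y) - frag_of (x', y) | x x' y.
       x \<in> carrier M \<and> x' \<in> carrier M \<and> y \<in> carrier N} \<union>
    {frag_of (x, y \<oplus>\<^bsub>N\<^esub> y') - frag_of (x, y) - frag_of (x, y') | x y y'.
       x \<in> carrier M \<and> y \<in> carrier N \<and> y' \<in> carrier N} \<union>
    {frag_of (ract M x a, y) - frag_of (x, a \<odot>\<^bsub>N\<^esub> y) | x a y.
       x \<in> carrier M \<and> a \<in> carrier A \<and> y \<in> carrier N}"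

definition tensor_subgroup ::
    "('a, 'c) ring_scheme \<Rightarrow> ('l, 'a, 'm) bimodule \<Rightarrow> ('a, 'r, 'n) bimodule \<Rightarrow> ('m \<times> 'n \<Rightarrow>\<^sub>0 int) set"
  where "tensor_subgroup A M N =
    generate (free_Abelian_group (carrier M \<times> carrier N)) (tensor_relators A M N)"

definition pure_tensor ::
    "('a, 'c) ring_scheme \<Rightarrow> ('l, 'a, 'm) bimodule \<Rightarrow> ('a, 'r, 'n) bimodule \<Rightarrow> 'm \<Rightarrow> 'n \<Rightarrow> ('m, 'n) tensor"
  where "pure_tensor A M N x y =
    tensor_subgroup A M N #>\<^bsub>free_Abelian_group (carrier M \<times> carrier N)\<^esub> frag_of (x, y)"

definition tensor_group ::
    "('a, 'c) ring_scheme \<Rightarrow> ('l, 'a, 'm) bimodule \<Rightarrow> ('a, 'r, 'n) bimodule \<Rightarrow> ('m, 'n) tensor ring"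
  where "tensor_group A M N =
    (let G = free_Abelian_group (carrier M \<times> carrier N) Mod tensor_subgroup A M N
     in \<lparr>carrier = carrier G, monoid.mult = undefined, monoid.one = undefined,
         ring.zero = \<one>\<^bsub>G\<^esub>, ring.add = monoid.mult G\<rparr>)"

text \<open>
  For an additive group \<open>T\<close> and a biadditive \<open>A\<close>-balanced \<open>h :: M \<times> N \<rightarrow> T\<close>, the map
  \<open>tensor_lift T h\<close> is the additive map on \<open>M \<otimes>\<^sub>A N\<close> with \<open>x \<otimes> y \<mapsto> h x y\<close>: the extension of \<open>h\<close> to
  the free abelian group is constant on each coset, and \<open>the_elem\<close> extracts that value.
\<close>

definition tensor_lift ::
    "('t, 'e) ring_scheme \<Rightarrow> ('m \<Rightarrow> 'n \<Rightarrow> 't) \<Rightarrow> ('m, 'n) tensor \<Rightarrow> 't"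
  where "tensor_lift T h X =
    the_elem ((\<lambda>c. \<Oplus>\<^bsub>T\<^esub> p \<in> Poly_Mapping.keys c. [Poly_Mapping.lookup c p] \<cdot>\<^bsub>T\<^esub> h (fst p) (snd p)) ` X)"

definition tensor ::
    "('a, 'c) ring_scheme \<Rightarrow> ('l, 'a, 'm) bimodule \<Rightarrow> ('a, 'r, 'n) bimodule \<Rightarrow>
     ('l, 'r, ('m, 'n) tensor) bimodule"
  where "tensor A M N =
    \<lparr>carrier = carrier (tensor_group A M N), monoid.mult = undefined, monoid.one = undefined,
     ring.zero = ring.zero (tensor_group A M N), ring.add = ring.add (tensor_group A M N),
     smult = (\<lambda>l. tensor_lift (tensor_group A M N) (\<lambda>x y. pure_tensor A M N (l \<odot>\<^bsub>M\<^esub> x) y)),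
     ract = (\<lambda>t r. tensor_lift (tensor_group A M N) (\<lambda>x y. pure_tensor A M N x (ract N y r)) t)\<rparr>"

text \<open>\<open>tensor_map A M' N' f g\<close> is \<open>f \<otimes> g : M \<otimes>\<^sub>A N \<rightarrow> M' \<otimes>\<^sub>A N'\<close>.\<close>

definition tensor_map ::
    "('a, 'c) ring_scheme \<Rightarrow> ('l, 'a, 'm') bimodule \<Rightarrow> ('a, 'r, 'n') bimodule \<Rightarrow>
     ('m \<Rightarrow> 'm') \<Rightarrow> ('n \<Rightarrow> 'n') \<Rightarrow> ('m, 'n) tensor \<Rightarrow> ('m', 'n') tensor"
  where "tensor_map A M' N' f g =
    tensor_lift (tensor A M' N') (\<lambda>x y. pure_tensor A M' N' (f x) (g y))"

text \<open>\<open>(L \<otimes>\<^sub>A M) \<otimes>\<^sub>B N \<rightarrow> L \<otimes>\<^sub>A (M \<otimes>\<^sub>B N)\<close> and its inverse.\<close>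

definition assoc ::
    "('a, 'c) ring_scheme \<Rightarrow> ('b, 'd) ring_scheme \<Rightarrow>
     ('s, 'a, 'l) bimodule \<Rightarrow> ('a, 'b, 'm) bimodule \<Rightarrow> ('b, 't, 'n) bimodule \<Rightarrow>
     (('l, 'm) tensor, 'n) tensor \<Rightarrow> ('l, ('m, 'n) tensor) tensor"
  where "assoc A B L M N =
    tensor_lift (tensor A L (tensor B M N))
      (\<lambda>u z. tensor_lift (tensor A L (tensor B M N))
        (\<lambda>x y. pure_tensor A L (tensor B M N) x (pure_tensor B M N y z)) u)"

definition assoc_inv ::
    "('a, 'c) ring_scheme \<Rightarrow> ('b, 'd) ring_scheme \<Rightarrow>
     ('s, 'a, 'l) bimodule \<Rightarrow> ('a, 'b, 'm) bimodule \<Rightarrow> ('b, 't, 'n) bimodule \<Rightarrow>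
     ('l, ('m, 'n) tensor) tensor \<Rightarrow> (('l, 'm) tensor, 'n) tensor"
  where "assoc_inv A B L M N =
    tensor_lift (tensor B (tensor A L M) N)
      (\<lambda>x v. tensor_lift (tensor B (tensor A L M) N)
        (\<lambda>y z. pure_tensor B (tensor A L M) N (pure_tensor A L M x y) z) v)"

text \<open>
  \<open>regular B\<close> is \<open>B\<close> acted on by itself, or by any of its subrings, from both sides. It serves as the
  identity bimodule of \<open>B\<close>, as \<open>Ind B = \<^sub>BB\<^sub>A\<close> and as \<open>Res B = \<^sub>AB\<^sub>B\<close>.
\<close>

definition regular :: "('a, 'd) ring_scheme \<Rightarrow> ('a, 'a, 'a) bimodule"
  where "regular B =
    \<lparr>carrier = carrier B, monoid.mult = monoid.mult B, monoid.one = \<one>\<^bsub>B\<^esub>,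
     ring.zero = \<zero>\<^bsub>B\<^esub>, ring.add = ring.add B,
     smult = monoid.mult B, ract = monoid.mult B\<rparr>"

definition Ind :: "('a, 'd) ring_scheme \<Rightarrow> ('a, 'a, 'a) bimodule"
  where "Ind B = regular B"

definition Res :: "('a, 'd) ring_scheme \<Rightarrow> ('a, 'a, 'a) bimodule"
  where "Res B = regular B"

text \<open>The unit isomorphisms \<open>A \<otimes>\<^sub>A M \<cong> M\<close> and \<open>M \<otimes>\<^sub>A A \<cong> M\<close>.\<close>

definition lunit :: "('a, 'r, 'm) bimodule \<Rightarrow> ('a, 'm) tensor \<Rightarrow> 'm"
  where "lunit M = tensor_lift M (\<lambda>a x. a \<odot>\<^bsub>M\<^esub> x)"

definition lunit_inv :: "('a, 'c) ring_scheme \<Rightarrow> ('a, 'r, 'm) bimodule \<Rightarrow> 'm \<Rightarrow> ('a, 'm) tensor"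
  where "lunit_inv A M x = pure_tensor A (regular A) M \<one>\<^bsub>A\<^esub> x"

definition runit :: "('l, 'a, 'm) bimodule \<Rightarrow> ('m, 'a) tensor \<Rightarrow> 'm"
  where "runit M = tensor_lift M (\<lambda>x a. ract M x a)"

definition runit_inv :: "('a, 'c) ring_scheme \<Rightarrow> ('l, 'a, 'm) bimodule \<Rightarrow> 'm \<Rightarrow> ('m, 'a) tensor"
  where "runit_inv A M x = pure_tensor A M (regular A) x \<one>\<^bsub>A\<^esub>"


section \<open>Adjunctions and mates\<close>

text \<open>
  Bimodules are functors, composed by tensor product: an \<open>(S, T)\<close>-bimodule \<open>F\<close> goes from \<open>T\<close> to \<open>S\<close>.
  An adjunction \<open>F \<stileturn> G\<close> is given by a unit \<open>T \<rightarrow> G \<otimes>\<^sub>S F\<close> and a counit \<open>F \<otimes>\<^sub>T G \<rightarrow> S\<close>.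

  The composite of \<open>F\<^sub>1 \<stileturn> G\<^sub>1\<close> (with \<open>F\<^sub>1\<close> an \<open>(S, B)\<close>-bimodule) and \<open>F\<^sub>2 \<stileturn> G\<^sub>2\<close> (with \<open>F\<^sub>2\<close> a
  \<open>(B, T)\<close>-bimodule) is \<open>F\<^sub>1 \<otimes>\<^sub>B F\<^sub>2 \<stileturn> G\<^sub>2 \<otimes>\<^sub>B G\<^sub>1\<close>.
\<close>

text \<open>
  \<open>T \<rightarrow> G\<^sub>2 \<otimes> F\<^sub>2 \<rightarrow> (G\<^sub>2 \<otimes> B) \<otimes> F\<^sub>2 \<rightarrow> (G\<^sub>2 \<otimes> (G\<^sub>1 \<otimes> F\<^sub>1)) \<otimes> F\<^sub>2 \<rightarrow> (G\<^sub>2 \<otimes> G\<^sub>1) \<otimes> (F\<^sub>1 \<otimes> F\<^sub>2)\<close>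
\<close>

definition comp_unit ::
    "('s, 'c) ring_scheme \<Rightarrow> ('b, 'd) ring_scheme \<Rightarrow>
     ('s, 'b, 'f1) bimodule \<Rightarrow> ('b, 't, 'f2) bimodule \<Rightarrow>
     ('b, 's, 'g1) bimodule \<Rightarrow> ('t, 'b, 'g2) bimodule \<Rightarrow>
     ('b \<Rightarrow> ('g1, 'f1) tensor) \<Rightarrow> ('t \<Rightarrow> ('g2, 'f2) tensor) \<Rightarrow>
     't \<Rightarrow> (('g2, 'g1) tensor, ('f1, 'f2) tensor) tensor"
  where "comp_unit S B F1 F2 G1 G2 \<eta>1 \<eta>2 =
    assoc S B (tensor B G2 G1) F1 F2 \<circ>
    tensor_map B (tensor S (tensor B G2 G1) F1) F2 (assoc_inv B S G2 G1 F1) id \<circ>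
    tensor_map B (tensor B G2 (tensor S G1 F1)) F2 (tensor_map B G2 (tensor S G1 F1) id \<eta>1) id \<circ>
    tensor_map B (tensor B G2 (regular B)) F2 (runit_inv B G2) id \<circ>
    \<eta>2"

text \<open>
  \<open>(F\<^sub>1 \<otimes> F\<^sub>2) \<otimes> (G\<^sub>2 \<otimes> G\<^sub>1) \<rightarrow> F\<^sub>1 \<otimes> ((F\<^sub>2 \<otimes> G\<^sub>2) \<otimes> G\<^sub>1) \<rightarrow> F\<^sub>1 \<otimes> (B \<otimes> G\<^sub>1) \<rightarrow> F\<^sub>1 \<otimes> G\<^sub>1 \<rightarrow> S\<close>
\<close>

definition comp_counit ::
    "('t, 'c) ring_scheme \<Rightarrow> ('b, 'd) ring_scheme \<Rightarrow>
     ('s, 'b, 'f1) bimodule \<Rightarrow> ('b, 't, 'f2) bimodule \<Rightarrow>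
     ('b, 's, 'g1) bimodule \<Rightarrow> ('t, 'b, 'g2) bimodule \<Rightarrow>
     (('f1, 'g1) tensor \<Rightarrow> 's) \<Rightarrow> (('f2, 'g2) tensor \<Rightarrow> 'b) \<Rightarrow>
     (('f1, 'f2) tensor, ('g2, 'g1) tensor) tensor \<Rightarrow> 's"
  where "comp_counit T B F1 F2 G1 G2 \<epsilon>1 \<epsilon>2 =
    \<epsilon>1 \<circ>
    tensor_map B F1 G1 id (lunit G1) \<circ>
    tensor_map B F1 (tensor B (regular B) G1) id (tensor_map B (regular B) G1 \<epsilon>2 id) \<circ>
    tensor_map B F1 (tensor B (tensor T F2 G2) G1) id (assoc_inv T B F2 G2 G1) \<circ>
    assoc B T F1 F2 (tensor B G2 G1)"

text \<open>
  For \<open>(S, T)\<close>-bimodules \<open>P\<close>, \<open>Q\<close> and \<open>\<phi> : P \<rightarrow> Q\<close>, the mate with respect to \<open>P \<stileturn> P'\<close> and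
  \<open>Q \<stileturn> Q'\<close>: \<open>Q' \<rightarrow> T \<otimes> Q' \<rightarrow> (P' \<otimes> P) \<otimes> Q' \<rightarrow> (P' \<otimes> Q) \<otimes> Q' \<rightarrow> P' \<otimes> (Q \<otimes> Q') \<rightarrow> P' \<otimes> S \<rightarrow> P'\<close>.
\<close>

definition mate_left ::
    "('s, 'c) ring_scheme \<Rightarrow> ('t, 'd) ring_scheme \<Rightarrow>
     ('s, 't, 'p) bimodule \<Rightarrow> ('t, 's, 'p') bimodule \<Rightarrow>
     ('s, 't, 'q) bimodule \<Rightarrow> ('t, 's, 'q') bimodule \<Rightarrow>
     ('t \<Rightarrow> ('p', 'p) tensor) \<Rightarrow> (('q, 'q') tensor \<Rightarrow> 's) \<Rightarrow> ('p \<Rightarrow> 'q) \<Rightarrow> 'q' \<Rightarrow> 'p'"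
  where "mate_left S T P P' Q Q' \<eta> \<epsilon> \<phi> =
    runit P' \<circ>
    tensor_map S P' (regular S) id \<epsilon> \<circ>
    assoc S T P' Q Q' \<circ>
    tensor_map T (tensor S P' Q) Q' (tensor_map S P' Q id \<phi>) id \<circ>
    tensor_map T (tensor S P' P) Q' \<eta> id \<circ>
    lunit_inv T Q'"

text \<open>
  The mate with respect to \<open>P' \<stileturn> P\<close> and \<open>Q' \<stileturn> Q\<close>:
  \<open>Q' \<rightarrow> Q' \<otimes> S \<rightarrow> Q' \<otimes> (P \<otimes> P') \<rightarrow> Q' \<otimes> (Q \<otimes> P') \<rightarrow> (Q' \<otimes> Q) \<otimes> P' \<rightarrow> T \<otimes> P' \<rightarrow> P'\<close>.
\<close>

definition mate_right ::
    "('s, 'c) ring_scheme \<Rightarrow> ('t, 'd) ring_scheme \<Rightarrow>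
     ('s, 't, 'p) bimodule \<Rightarrow> ('t, 's, 'p') bimodule \<Rightarrow>
     ('s, 't, 'q) bimodule \<Rightarrow> ('t, 's, 'q') bimodule \<Rightarrow>
     ('s \<Rightarrow> ('p, 'p') tensor) \<Rightarrow> (('q', 'q) tensor \<Rightarrow> 't) \<Rightarrow> ('p \<Rightarrow> 'q) \<Rightarrow> 'q' \<Rightarrow> 'p'"
  where "mate_right S T P P' Q Q' \<eta> \<epsilon> \<phi> =
    lunit P' \<circ>
    tensor_map T (regular T) P' \<epsilon> id \<circ>
    assoc_inv S T Q' Q P' \<circ>
    tensor_map S Q' (tensor T Q P') id (tensor_map T Q P' \<phi> id) \<circ>
    tensor_map S Q' (tensor T P P') id \<eta> \<circ>
    runit_inv S Q'"


section \<open>The biadjunction of a Frobenius extension\<close>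

text \<open>
  For \<open>A \<subseteq> B\<close>: the inclusion \<open>A \<rightarrow> Res \<otimes>\<^sub>B Ind\<close> (where \<open>Res \<otimes>\<^sub>B Ind = B \<otimes>\<^sub>B B\<close> is identified with
  \<open>\<^sub>AB\<^sub>A\<close> by multiplication, so \<open>b\<close> corresponds to \<open>b \<otimes> 1\<close>) and the multiplication
  \<open>Ind \<otimes>\<^sub>A Res \<rightarrow> B\<close> are the unit and counit of \<open>Ind \<stileturn> Res\<close>.
\<close>

definition incl_unit :: "('a, 'd) ring_scheme \<Rightarrow> 'a \<Rightarrow> ('a, 'a) tensor"
  where "incl_unit B a = pure_tensor B (Res B) (Ind B) a \<one>\<^bsub>B\<^esub>"

definition mult_counit :: "('a, 'd) ring_scheme \<Rightarrow> ('a, 'a) tensor \<Rightarrow> 'a"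
  where "mult_counit B = tensor_lift (regular B) (\<lambda>x y. x \<otimes>\<^bsub>B\<^esub> y)"

text \<open>
  The comultiplication \<open>B \<rightarrow> Ind \<otimes>\<^sub>A Res\<close> and the trace \<open>Res \<otimes>\<^sub>B Ind \<rightarrow> A\<close> are the unit and counit of
  \<open>Res \<stileturn> Ind\<close>. The element \<open>\<Sum>\<^sub>i x\<^sub>i \<otimes> y\<^sub>i\<close> does not depend on the dual bases, hence \<open>THE\<close>.
\<close>

definition comult_one ::
    "('a, 'c) ring_scheme \<Rightarrow> ('a, 'd) ring_scheme \<Rightarrow> ('a \<Rightarrow> 'a) \<Rightarrow> ('a, 'a) tensor"
  where "comult_one A B \<delta> = (THE t. \<exists>n x y. dual_bases A B \<delta> n x y \<and>
    t = (\<Oplus>\<^bsub>tensor A (Ind B) (Res B)\<^esub> i \<in> {..<n}. pure_tensor A (Ind B) (Res B) (x i) (y i)))"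

definition comult_unit ::
    "('a, 'c) ring_scheme \<Rightarrow> ('a, 'd) ring_scheme \<Rightarrow> ('a \<Rightarrow> 'a) \<Rightarrow> 'a \<Rightarrow> ('a, 'a) tensor"
  where "comult_unit A B \<delta> b = b \<odot>\<^bsub>tensor A (Ind B) (Res B)\<^esub> comult_one A B \<delta>"

definition trace_counit ::
    "('a, 'c) ring_scheme \<Rightarrow> ('a, 'd) ring_scheme \<Rightarrow> ('a \<Rightarrow> 'a) \<Rightarrow> ('a, 'a) tensor \<Rightarrow> 'a"
  where "trace_counit A B \<delta> = tensor_lift (regular A) (\<lambda>x y. \<delta> (x \<otimes>\<^bsub>B\<^esub> y))"

text \<open>
  For a tower \<open>T \<subseteq> B \<subseteq> R\<close>, the composites \<open>Ind\<^sub>B\<^sup>R Ind\<^sub>T\<^sup>B = R \<otimes>\<^sub>B B\<close> and \<open>Res\<^sub>T\<^sup>B Res\<^sub>B\<^sup>R = B \<otimes>\<^sub>B R\<close>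
  with their composite biadjunction.
\<close>

definition IndInd :: "('a, 'c) ring_scheme \<Rightarrow> ('a, 'd) ring_scheme \<Rightarrow> ('a, 'a, ('a, 'a) tensor) bimodule"
  where "IndInd B R = tensor B (Ind R) (Ind B)"

definition ResRes :: "('a, 'c) ring_scheme \<Rightarrow> ('a, 'd) ring_scheme \<Rightarrow> ('a, 'a, ('a, 'a) tensor) bimodule"
  where "ResRes B R = tensor B (Res B) (Res R)"

text \<open>\<open>IndInd \<stileturn> ResRes\<close>\<close>

definition ind_res_unit ::
    "('a, 'c) ring_scheme \<Rightarrow> ('a, 'd) ring_scheme \<Rightarrow> 'a \<Rightarrow> (('a, 'a) tensor, ('a, 'a) tensor) tensor"
  where "ind_res_unit B R =
    comp_unit R B (Ind R) (Ind B) (Res R) (Res B) (incl_unit R) (incl_unit B)"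

definition ind_res_counit ::
    "('a, 'c) ring_scheme \<Rightarrow> ('a, 'd) ring_scheme \<Rightarrow> ('a, 'e) ring_scheme \<Rightarrow>
     (('a, 'a) tensor, ('a, 'a) tensor) tensor \<Rightarrow> 'a"
  where "ind_res_counit T B R =
    comp_counit T B (Ind R) (Ind B) (Res R) (Res B) (mult_counit R) (mult_counit B)"

text \<open>\<open>ResRes \<stileturn> IndInd\<close>\<close>

definition res_ind_unit ::
    "('a, 'c) ring_scheme \<Rightarrow> ('a, 'd) ring_scheme \<Rightarrow> ('a, 'e) ring_scheme \<Rightarrow> ('a \<Rightarrow> 'a) \<Rightarrow> ('a \<Rightarrow> 'a) \<Rightarrow>
     'a \<Rightarrow> (('a, 'a) tensor, ('a, 'a) tensor) tensor"
  where "res_ind_unit T B R \<delta>R \<delta>B =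
    comp_unit T B (Res B) (Res R) (Ind B) (Ind R) (comult_unit T B \<delta>B) (comult_unit B R \<delta>R)"

definition res_ind_counit ::
    "('a, 'c) ring_scheme \<Rightarrow> ('a, 'd) ring_scheme \<Rightarrow> ('a, 'e) ring_scheme \<Rightarrow> ('a \<Rightarrow> 'a) \<Rightarrow> ('a \<Rightarrow> 'a) \<Rightarrow>
     (('a, 'a) tensor, ('a, 'a) tensor) tensor \<Rightarrow> 'a"
  where "res_ind_counit T B R \<delta>R \<delta>B =
    comp_counit R B (Res B) (Res R) (Ind B) (Ind R) (trace_counit T B \<delta>B) (trace_counit B R \<delta>R)"

text \<open>
  For \<open>B, B' \<subseteq> R\<close>, the map \<open>R \<otimes>\<^sub>B B \<rightarrow> R \<otimes>\<^sub>B\<^sub>' B'\<close>, \<open>f \<otimes> 1 \<mapsto> f \<otimes> 1\<close>;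
  since \<open>f \<otimes> g = f g \<otimes> 1\<close>, it is \<open>f \<otimes> g \<mapsto> f g \<otimes> 1\<close>.
\<close>

definition induction_map ::
    "('a, 'c) ring_scheme \<Rightarrow> ('a, 'd) ring_scheme \<Rightarrow> ('a, 'e) ring_scheme \<Rightarrow> ('a, 'a) tensor \<Rightarrow> ('a, 'a) tensor"
  where "induction_map B B' R =
    tensor_lift (IndInd B' R) (\<lambda>f g. pure_tensor B' (Ind R) (Ind B') (f \<otimes>\<^bsub>R\<^esub> g) \<one>\<^bsub>B'\<^esub>)"

end

theory Submission
  imports Defs
begin

text \<open>
  Both rotations can be evaluated on \<open>a \<otimes> f\<close>. The left mate involves only units and multiplications and
  gives \<open>1 \<otimes> a f\<close>. The right mate gives \<open>\<Sum>\<^sub>i\<^sub>j \<partial>(a f x\<^sub>i u\<^sub>j) v\<^sub>j \<otimes> y\<^sub>i\<close>, where \<open>x, y\<close> are dual bases of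
  \<open>R\<close> over \<open>R\<^sup>b\<close>, \<open>u, v\<close> are dual bases of \<open>R\<^sup>b\<close> over \<open>R\<^sup>r\<^sup>b\<close>, and \<open>\<partial>\<close> is the trace \<open>R \<rightarrow> R\<^sup>r\<^sup>b\<close> through
  \<open>R\<^sup>r\<close>. By compatibility \<open>\<partial>\<close> may be computed through \<open>R\<^sup>b\<close> instead, and then the two dual-basis
  expansions collapse the sum to \<open>1 \<otimes> a f\<close>. Exchanging the two colours gives the inverse of the
  induction map and of the left mate.
\<close>

section \<open>Bimodules and additive maps\<close>

text \<open>A tensor is a coset of integer combinations of pairs, and every structural map is a
  total function whose values mean something only on the right carriers. No map can be computed
  before it is known to be well defined, so each one receives two facts: a typing judgement saying
  that it is a bimodule map, and its value on pure tensors. Together they determine it on the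
  carrier, because additive maps that agree on pure tensors agree on all tensors.

  The two mates differ in their units. Inclusion sends 1 to a single pure tensor; comultiplication
  sends it to a sum over dual bases, selected by a definite description. That sum has to be shown
  independent of the bases, central, and able to pass through every map of the composite.

  Compatibility enters because unit and counit of the right mate come from opposite colours: the
  unit supplies dual bases along \<open>R\<^sup>b\<close>, the counit a trace through
  \<open>R\<^sup>r\<close>, and a dual-basis expansion applies only to the trace that its bases are
  dual for.\<close>

locale bimod = A: ring A + B: ring B + M: abelian_group M
  for A :: "('a, 'c) ring_scheme" and B :: "('b, 'd) ring_scheme"
    and M :: "('a, 'b, 'm) bimodule" +
  assumes l_closed: "\<lbrakk>a \<in> carrier A; x \<in> carrier M\<rbrakk> \<Longrightarrow> a \<odot>\<^bsub>M\<^esub> x \<in> carrier M"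
    and r_closed: "\<lbrakk>x \<in> carrier M; b \<in> carrier B\<rbrakk> \<Longrightarrow> ract M x b \<in> carrier M"
    and l_distr_scalar: "\<lbrakk>a \<in> carrier A; a' \<in> carrier A; x \<in> carrier M\<rbrakk> \<Longrightarrow>
      (a \<oplus>\<^bsub>A\<^esub> a') \<odot>\<^bsub>M\<^esub> x = a \<odot>\<^bsub>M\<^esub> x \<oplus>\<^bsub>M\<^esub> a' \<odot>\<^bsub>M\<^esub> x"
    and l_distr: "\<lbrakk>a \<in> carrier A; x \<in> carrier M; y \<in> carrier M\<rbrakk> \<Longrightarrow>
      a \<odot>\<^bsub>M\<^esub> (x \<oplus>\<^bsub>M\<^esub> y) = a \<odot>\<^bsub>M\<^esub> x \<oplus>\<^bsub>M\<^esub> a \<odot>\<^bsub>M\<^esub> y"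
    and r_distr_scalar: "\<lbrakk>x \<in> carrier M; b \<in> carrier B; b' \<in> carrier B\<rbrakk> \<Longrightarrow>
      ract M x (b \<oplus>\<^bsub>B\<^esub> b') = ract M x b \<oplus>\<^bsub>M\<^esub> ract M x b'"
    and r_distr: "\<lbrakk>x \<in> carrier M; y \<in> carrier M; b \<in> carrier B\<rbrakk> \<Longrightarrow>
      ract M (x \<oplus>\<^bsub>M\<^esub> y) b = ract M x b \<oplus>\<^bsub>M\<^esub> ract M y b"
    and l_assoc: "\<lbrakk>a \<in> carrier A; a' \<in> carrier A; x \<in> carrier M\<rbrakk> \<Longrightarrow>
      (a \<otimes>\<^bsub>A\<^esub> a') \<odot>\<^bsub>M\<^esub> x = a \<odot>\<^bsub>M\<^esub> (a' \<odot>\<^bsub>M\<^esub> x)"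
    and r_assoc: "\<lbrakk>x \<in> carrier M; b \<in> carrier B; b' \<in> carrier B\<rbrakk> \<Longrightarrow>
      ract M x (b \<otimes>\<^bsub>B\<^esub> b') = ract M (ract M x b) b'"
    and lr_assoc: "\<lbrakk>a \<in> carrier A; x \<in> carrier M; b \<in> carrier B\<rbrakk> \<Longrightarrow>
      ract M (a \<odot>\<^bsub>M\<^esub> x) b = a \<odot>\<^bsub>M\<^esub> ract M x b"
    and l_one: "x \<in> carrier M \<Longrightarrow> \<one>\<^bsub>A\<^esub> \<odot>\<^bsub>M\<^esub> x = x"
    and r_one: "x \<in> carrier M \<Longrightarrow> ract M x \<one>\<^bsub>B\<^esub> = x"

text \<open>Linearity is left out on purpose: acting by one fixed scalar, or filling one slot of a
  tensor with a fixed element, is in general additive without being linear, and additivity is what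
  induction over tensors consumes.\<close>

definition additive :: "('m, 'c) ring_scheme \<Rightarrow> ('n, 'd) ring_scheme \<Rightarrow> ('m \<Rightarrow> 'n) \<Rightarrow> bool"
  where "additive M N h \<longleftrightarrow> h \<in> carrier M \<rightarrow> carrier N \<and>
    (\<forall>x \<in> carrier M. \<forall>y \<in> carrier M. h (x \<oplus>\<^bsub>M\<^esub> y) = h x \<oplus>\<^bsub>N\<^esub> h y)"

lemma additiveI:
  assumes "\<And>x. x \<in> carrier M \<Longrightarrow> h x \<in> carrier N"
    and "\<And>x y. \<lbrakk>x \<in> carrier M; y \<in> carrier M\<rbrakk> \<Longrightarrow> h (x \<oplus>\<^bsub>M\<^esub> y) = h x \<oplus>\<^bsub>N\<^esub> h y"
  shows "additive M N h"
  using assms by (auto simp: additive_def)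

lemma additive_closed: "\<lbrakk>additive M N h; x \<in> carrier M\<rbrakk> \<Longrightarrow> h x \<in> carrier N"
  by (auto simp: additive_def)

lemma additive_add:
  "\<lbrakk>additive M N h; x \<in> carrier M; y \<in> carrier M\<rbrakk> \<Longrightarrow> h (x \<oplus>\<^bsub>M\<^esub> y) = h x \<oplus>\<^bsub>N\<^esub> h y"
  by (auto simp: additive_def)

lemma additive_comp: "\<lbrakk>additive L M g; additive M N h\<rbrakk> \<Longrightarrow> additive L N (h \<circ> g)"
  by (auto simp: additive_def Pi_iff)

lemma additive_group_hom:
  assumes "additive M N h" "abelian_group M" "abelian_group N"
  shows "group_hom (add_monoid M) (add_monoid N) h"
  using assms by (auto simp: group_hom_def group_hom_axioms_def hom_def additive_def abelian_group.a_group)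

lemma additive_zero:
  assumes "additive M N h" "abelian_group M" "abelian_group N"
  shows "h \<zero>\<^bsub>M\<^esub> = \<zero>\<^bsub>N\<^esub>"
  using group_hom.hom_one[OF additive_group_hom[OF assms]] by simp

lemma additive_finsum:
  assumes h: "additive M N h" "abelian_group M" "abelian_group N"
    and "f \<in> I \<rightarrow> carrier M"
  shows "h (finsum M f I) = finsum N (\<lambda>i. h (f i)) I"
proof -
  interpret M: abelian_group M by fact
  interpret N: abelian_group N by fact
  show ?thesis
    using assms(4)
  proof (induction I rule: infinite_finite_induct)
    \<comment> \<open>By convention both sums are zero here, so the claim reduces to preservation of
      zero.\<close>
    case (infinite I)
    then show ?case using additive_zero[OF h] by (simp add: M.finsum_infinite N.finsum_infinite)
  next
    case empty
    then show ?case using additive_zero[OF h] by simp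
  next
    case (insert i I)
    have "(\<lambda>i. h (f i)) \<in> I \<rightarrow> carrier N" "h (f i) \<in> carrier N"
      using insert.prems h(1) by (auto intro!: additive_closed[OF h(1)])
    moreover have "f \<in> I \<rightarrow> carrier M" "f i \<in> carrier M"
      using insert.prems by auto
    ultimately show ?case
      using insert by (simp add: M.finsum_insert N.finsum_insert additive_add[OF h(1)])
  qed
qed

lemma (in abelian_monoid) finsum_swap:
  assumes "finite I" "finite J" and f: "\<And>i j. \<lbrakk>i \<in> I; j \<in> J\<rbrakk> \<Longrightarrow> f i j \<in> carrier G"
  shows "(\<Oplus>i \<in> I. \<Oplus> j \<in> J. f i j) = (\<Oplus>j \<in> J. \<Oplus> i \<in> I. f i j)"
  using assms(1) f
proof (induction I rule: finite_induct)
  case empty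
  then show ?case by (simp add: finsum_zero)
next
  case (insert i I)
  have "(\<Oplus>j \<in> J. \<Oplus> k \<in> insert i I. f k j) = (\<Oplus>j \<in> J. f i j \<oplus> (\<Oplus> k \<in> I. f k j))"
    using insert by (intro finsum_cong' refl) (auto intro!: finsum_closed finsum_insert)
  also have "\<dots> = (\<Oplus>j \<in> J. f i j) \<oplus> (\<Oplus>j \<in> J. \<Oplus> k \<in> I. f k j)"
    using insert by (intro finsum_addf) (auto intro!: finsum_closed)
  finally show ?case
    using insert by (subst finsum_insert) (auto intro!: finsum_closed)
qed

section \<open>Balanced maps and homomorphisms out of a free abelian group\<close>

text \<open>The clauses mirror the three families in \<open>tensor_relators\<close>, so these are
  exactly the conditions under which the linear extension of \<open>h\<close> kills every
  relator.\<close>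

definition balanced ::
    "('a, 'c) ring_scheme \<Rightarrow> ('l, 'a, 'm) bimodule \<Rightarrow> ('a, 'r, 'n) bimodule \<Rightarrow>
     ('t, 'e) ring_scheme \<Rightarrow> ('m \<Rightarrow> 'n \<Rightarrow> 't) \<Rightarrow> bool"
  where "balanced A M N X h \<longleftrightarrow>
    (\<forall>x \<in> carrier M. additive N X (h x)) \<and>
    (\<forall>y \<in> carrier N. additive M X (\<lambda>x. h x y)) \<and>
    (\<forall>x \<in> carrier M. \<forall>a \<in> carrier A. \<forall>y \<in> carrier N. h (ract M x a) y = h x (a \<odot>\<^bsub>N\<^esub> y))"

lemma balancedI:
  assumes "\<And>x y. \<lbrakk>x \<in> carrier M; y \<in> carrier N\<rbrakk> \<Longrightarrow> h x y \<in> carrier X"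
    and "\<And>x x' y. \<lbrakk>x \<in> carrier M; x' \<in> carrier M; y \<in> carrier N\<rbrakk> \<Longrightarrow> h (x \<oplus>\<^bsub>M\<^esub> x') y = h x y \<oplus>\<^bsub>X\<^esub> h x' y"
    and "\<And>x y y'. \<lbrakk>x \<in> carrier M; y \<in> carrier N; y' \<in> carrier N\<rbrakk> \<Longrightarrow> h x (y \<oplus>\<^bsub>N\<^esub> y') = h x y \<oplus>\<^bsub>X\<^esub> h x y'"
    and "\<And>x a y. \<lbrakk>x \<in> carrier M; a \<in> carrier A; y \<in> carrier N\<rbrakk> \<Longrightarrow> h (ract M x a) y = h x (a \<odot>\<^bsub>N\<^esub> y)"
  shows "balanced A M N X h"
  using assms by (auto simp: balanced_def additive_def)

lemma balanced_closed: "\<lbrakk>balanced A M N X h; x \<in> carrier M; y \<in> carrier N\<rbrakk> \<Longrightarrow> h x y \<in> carrier X"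
  by (auto simp: balanced_def additive_def)

text \<open>The quotient of the free abelian group is a multiplicative structure, whereas
  \<open>tensor_group\<close> stores the same operation as addition; this transports the group laws
  between the two encodings.\<close>

lemma comm_group_imp_abelian_group:
  assumes "comm_group G" and "carrier X = carrier G" "ring.add X = monoid.mult G" "ring.zero X = \<one>\<^bsub>G\<^esub>"
  shows "abelian_group X"
proof -
  interpret comm_group G by fact
  show ?thesis
    using l_inv_ex by (intro abelian_groupI) (auto simp: assms(2-) m_assoc intro: m_comm)
qed

text \<open>The universal property of the free abelian group, in the explicit form that occurs in
  \<open>tensor_lift\<close>.\<close>

lemma finsum_frag_hom:
  assumes "abelian_group X" and h: "\<And>p. p \<in> S \<Longrightarrow> h p \<in> carrier X"
  shows "(\<lambda>c. \<Oplus>\<^bsub>X\<^esub> p \<in> Poly_Mapping.keys c. [Poly_Mapping.lookup c p] \<cdot>\<^bsub>X\<^esub> h p)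
    \<in> hom (free_Abelian_group S) (add_monoid X)"
proof -
  interpret X: abelian_group X by fact
  let ?F = "\<lambda>c. \<Oplus>\<^bsub>X\<^esub> p \<in> Poly_Mapping.keys c. [Poly_Mapping.lookup c p] \<cdot>\<^bsub>X\<^esub> h p"
  have clo: "[n] \<cdot>\<^bsub>X\<^esub> h p \<in> carrier X" if "p \<in> S" for p and n :: int
    using X.add.int_pow_closed[OF h[OF that]] .
  \<comment> \<open>Cancellation can make the support of \<open>c + d\<close> smaller than the union
    of the supports. Terms outside the support have coefficient zero, so all three sums may be taken
    over that union.\<close>
  have ext: "?F c = (\<Oplus>\<^bsub>X\<^esub> p \<in> J. [Poly_Mapping.lookup c p] \<cdot>\<^bsub>X\<^esub> h p)"
    if "finite J" "Poly_Mapping.keys c \<subseteq> J" "J \<subseteq> S" for c :: "_ \<Rightarrow>\<^sub>0 int" and J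
  proof (rule X.add.finprod_mono_neutral_cong_left)
    show "[Poly_Mapping.lookup c p] \<cdot>\<^bsub>X\<^esub> h p = \<zero>\<^bsub>X\<^esub>" if "p \<in> J - Poly_Mapping.keys c" for p
      using that by (simp add: in_keys_iff add_pow_def)
  qed (use that clo in auto)
  show ?thesis
  proof (rule homI)
    fix c assume "c \<in> carrier (free_Abelian_group S)"
    then show "?F c \<in> carrier (add_monoid X)"
      by (auto intro!: X.finsum_closed clo)
  next
    fix c d assume cd: "c \<in> carrier (free_Abelian_group S)" "d \<in> carrier (free_Abelian_group S)"
    let ?J = "Poly_Mapping.keys c \<union> Poly_Mapping.keys d"
    have J: "finite ?J" "?J \<subseteq> S" using cd by auto
    have "?F (c + d) = (\<Oplus>\<^bsub>X\<^esub> p \<in> ?J. [Poly_Mapping.lookup (c + d) p] \<cdot>\<^bsub>X\<^esub> h p)"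
      using J keys_add[of c d] by (intro ext) auto
    also have "\<dots> = (\<Oplus>\<^bsub>X\<^esub> p \<in> ?J. [Poly_Mapping.lookup c p] \<cdot>\<^bsub>X\<^esub> h p \<oplus>\<^bsub>X\<^esub> [Poly_Mapping.lookup d p] \<cdot>\<^bsub>X\<^esub> h p)"
      using J by (intro X.finsum_cong' refl)
        (auto simp: lookup_add X.add.int_pow_mult h clo subset_iff)
    also have "\<dots> = (\<Oplus>\<^bsub>X\<^esub> p \<in> ?J. [Poly_Mapping.lookup c p] \<cdot>\<^bsub>X\<^esub> h p) \<oplus>\<^bsub>X\<^esub> (\<Oplus>\<^bsub>X\<^esub> p \<in> ?J. [Poly_Mapping.lookup d p] \<cdot>\<^bsub>X\<^esub> h p)"
      using J by (intro X.finsum_addf) (auto intro!: clo)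
    also have "\<dots> = ?F c \<oplus>\<^bsub>X\<^esub> ?F d"
      using J by (simp add: ext[of ?J c] ext[of ?J d])
    finally show "?F (c \<otimes>\<^bsub>free_Abelian_group S\<^esub> d) = ?F c \<otimes>\<^bsub>add_monoid X\<^esub> ?F d"
      by simp
  qed
qed

section \<open>Tensor products\<close>

locale tensor_pair = M: bimod S A M + N: bimod A T N
  for S :: "('s, 'c) ring_scheme" and A :: "('a, 'd) ring_scheme" and T :: "('t, 'e) ring_scheme"
    and M :: "('s, 'a, 'm) bimodule" and N :: "('a, 't, 'n) bimodule"
begin

abbreviation "FG \<equiv> free_Abelian_group (carrier M \<times> carrier N)"
abbreviation "TS \<equiv> tensor_subgroup A M N"
abbreviation "MN \<equiv> tensor A M N"
abbreviation "pure \<equiv> pure_tensor A M N"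

sublocale FG: comm_group FG
  rewrites "x \<otimes>\<^bsub>FG\<^esub> y = x + y" and "\<one>\<^bsub>FG\<^esub> = 0"
  by (simp_all add: abelian_free_Abelian_group)

lemma relators_carrier: "tensor_relators A M N \<subseteq> carrier FG"
  unfolding tensor_relators_def
  by (auto dest!: subsetD[OF keys_diff] simp: M.r_closed N.l_closed M.M.a_closed N.M.a_closed)

lemma subgroup_TS: "subgroup TS FG"
  unfolding tensor_subgroup_def by (rule FG.generate_is_subgroup[OF relators_carrier])

lemma normal_TS: "TS \<lhd> FG"
  by (rule FG.subgroup_imp_normal[OF subgroup_TS])

interpretation quot: comm_group "FG Mod TS"
  by (rule FG.abelian_FactGroup[OF subgroup_TS])

lemma carrier_MN: "carrier MN = rcosets\<^bsub>FG\<^esub> TS"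
  by (simp add: tensor_def tensor_group_def Let_def FactGroup_def)

lemma add_MN: "X \<oplus>\<^bsub>MN\<^esub> Y = X <#>\<^bsub>FG\<^esub> Y"
  by (simp add: tensor_def tensor_group_def Let_def FactGroup_def)

lemma coset_add: "\<lbrakk>c \<in> carrier FG; d \<in> carrier FG\<rbrakk> \<Longrightarrow>
    (TS #>\<^bsub>FG\<^esub> c) \<oplus>\<^bsub>MN\<^esub> (TS #>\<^bsub>FG\<^esub> d) = TS #>\<^bsub>FG\<^esub> (c + d)"
  using normal.rcos_sum[OF normal_TS] by (simp add: add_MN)

lemma abelian_tensor_group: "abelian_group (tensor_group A M N)"
  by (rule comm_group_imp_abelian_group[OF quot.comm_group_axioms]) (simp_all add: tensor_group_def Let_def)

lemma abelian_MN: "abelian_group MN"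
  by (rule abelian_groupI) (use abelian_groupE[OF abelian_tensor_group] in \<open>simp_all add: tensor_def\<close>)

sublocale MN: abelian_group MN by (rule abelian_MN)

lemma pure_closed: "\<lbrakk>x \<in> carrier M; y \<in> carrier N\<rbrakk> \<Longrightarrow> pure x y \<in> carrier MN"
  by (auto simp: carrier_MN pure_tensor_def RCOSETS_def)

lemma coset_eqI:
  assumes "c - d \<in> TS" "c \<in> carrier FG" "d \<in> carrier FG"
  shows "TS #>\<^bsub>FG\<^esub> c = TS #>\<^bsub>FG\<^esub> d"
proof -
  have "c \<in> TS #>\<^bsub>FG\<^esub> d"
    using assms(1) by (auto simp: r_coset_def intro!: bexI[of _ "c - d"])
  then show ?thesis
    using FG.repr_independence[OF _ assms(3) subgroup_TS] by simp
qed

lemma relator_TS: "c \<in> tensor_relators A M N \<Longrightarrow> c \<in> TS"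
  unfolding tensor_subgroup_def by (rule generate.incl)

lemma pure_add_left:
  assumes "x \<in> carrier M" "x' \<in> carrier M" "y \<in> carrier N"
  shows "pure (x \<oplus>\<^bsub>M\<^esub> x') y = pure x y \<oplus>\<^bsub>MN\<^esub> pure x' y"
proof -
  have "frag_of (x \<oplus>\<^bsub>M\<^esub> x', y) - (frag_of (x, y) + frag_of (x', y)) \<in> TS"
    using assms by (intro relator_TS) (auto simp: tensor_relators_def)
  then show ?thesis
    using assms keys_add[of "frag_of (x, y)" "frag_of (x', y)"]
    by (simp add: pure_tensor_def coset_add) (intro coset_eqI, auto)
qed

lemma pure_add_right:
  assumes "x \<in> carrier M" "y \<in> carrier N" "y' \<in> carrier N"
  shows "pure x (y \<oplus>\<^bsub>N\<^esub> y') = pure x y \<oplus>\<^bsub>MN\<^esub> pure x y'"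
proof -
  have "frag_of (x, y \<oplus>\<^bsub>N\<^esub> y') - (frag_of (x, y) + frag_of (x, y')) \<in> TS"
    using assms by (intro relator_TS) (auto simp: tensor_relators_def)
  then show ?thesis
    using assms keys_add[of "frag_of (x, y)" "frag_of (x, y')"]
    by (simp add: pure_tensor_def coset_add) (intro coset_eqI, auto)
qed

lemma pure_balanced:
  assumes "x \<in> carrier M" "a \<in> carrier A" "y \<in> carrier N"
  shows "pure (ract M x a) y = pure x (a \<odot>\<^bsub>N\<^esub> y)"
proof -
  have "frag_of (ract M x a, y) - frag_of (x, a \<odot>\<^bsub>N\<^esub> y) \<in> TS"
    using assms by (intro relator_TS) (auto simp: tensor_relators_def)
  then show ?thesis
    using assms M.r_closed N.l_closed by (simp add: pure_tensor_def) (intro coset_eqI, auto)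
qed

text \<open>This is well-definedness of \<open>tensor_lift\<close>. The relators lie in the kernel
  of the linear extension, hence so does the subgroup that they generate; the extension is then
  constant on a coset, and \<open>the_elem\<close> is applied to a singleton.\<close>

lemma tensor_lift_coset:
  assumes X: "abelian_group X" and h: "balanced A M N X h" and c: "c \<in> carrier FG"
  shows "tensor_lift X h (TS #>\<^bsub>FG\<^esub> c) =
    (\<Oplus>\<^bsub>X\<^esub> p \<in> Poly_Mapping.keys c. [Poly_Mapping.lookup c p] \<cdot>\<^bsub>X\<^esub> h (fst p) (snd p))"
proof -
  interpret X: abelian_group X by fact
  let ?F = "\<lambda>c. \<Oplus>\<^bsub>X\<^esub> p \<in> Poly_Mapping.keys c. [Poly_Mapping.lookup c p] \<cdot>\<^bsub>X\<^esub> h (fst p) (snd p)"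
  have "?F \<in> hom FG (add_monoid X)"
    using finsum_frag_hom[OF X, of "carrier M \<times> carrier N" "\<lambda>p. h (fst p) (snd p)"]
      balanced_closed[OF h] by auto
  then interpret F: group_hom FG "add_monoid X" ?F
    by (simp add: group_hom_def group_hom_axioms_def X.a_group)
  have F_of: "?F (frag_of p) = h (fst p) (snd p)" if "p \<in> carrier M \<times> carrier N" for p
    using that balanced_closed[OF h] by (auto simp: X.finsum_insert)
  have F_diff: "?F (c - d) = ?F c \<ominus>\<^bsub>X\<^esub> ?F d" if "c \<in> carrier FG" "d \<in> carrier FG" for c d
  proof -
    have "?F (c + (- d)) = ?F c \<oplus>\<^bsub>X\<^esub> ?F (- d)"
      using that F.hom_mult[of c "- d"] by (simp add: keys_minus)
    moreover have "?F (- d) = \<ominus>\<^bsub>X\<^esub> ?F d"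
      using that F.hom_inv[of d] by (simp add: a_inv_def)
    ultimately show ?thesis by (simp add: a_minus_def)
  qed
  have "?F d = \<zero>\<^bsub>X\<^esub>" if "d \<in> tensor_relators A M N" for d
  proof -
    note hc = balanced_closed[OF h]
    have d2: "?F (frag_of p - frag_of q) = h (fst p) (snd p) \<ominus>\<^bsub>X\<^esub> h (fst q) (snd q)"
      if "p \<in> carrier M \<times> carrier N" "q \<in> carrier M \<times> carrier N" for p q
      using that by (subst F_diff) (auto simp only: F_of, auto)
    have d3: "?F (frag_of p - frag_of q - frag_of r) =
        h (fst p) (snd p) \<ominus>\<^bsub>X\<^esub> h (fst q) (snd q) \<ominus>\<^bsub>X\<^esub> h (fst r) (snd r)"
      if "p \<in> carrier M \<times> carrier N" "q \<in> carrier M \<times> carrier N" "r \<in> carrier M \<times> carrier N" for p q r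
      using that keys_diff[of "frag_of p" "frag_of q"]
      by (subst F_diff) (auto simp only: F_of d2, auto)
    \<comment> \<open>Both additivity relators take this form once \<open>h\<close> has been
      expanded in the relevant variable.\<close>
    have cancel: "u \<oplus>\<^bsub>X\<^esub> v \<ominus>\<^bsub>X\<^esub> u \<ominus>\<^bsub>X\<^esub> v = \<zero>\<^bsub>X\<^esub>" if "u \<in> carrier X" "v \<in> carrier X" for u v
      using that by (metis X.a_ac(2) X.add.inv_closed X.add.m_assoc X.add.r_inv X.a_closed X.r_zero a_minus_def)
    from that show ?thesis
      unfolding tensor_relators_def
    proof (elim UnE CollectE exE conjE)
      fix x x' y assume "d = frag_of (x \<oplus>\<^bsub>M\<^esub> x', y) - frag_of (x, y) - frag_of (x', y)"
        and xy: "x \<in> carrier M" "x' \<in> carrier M" "y \<in> carrier N"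
      then show ?thesis
        using h by (simp only: d3 mem_Times_iff fst_conv snd_conv M.M.a_closed simp_thms)
          (simp add: balanced_def additive_def Pi_iff cancel)
    next
      fix x y y' assume "d = frag_of (x, y \<oplus>\<^bsub>N\<^esub> y') - frag_of (x, y) - frag_of (x, y')"
        and xy: "x \<in> carrier M" "y \<in> carrier N" "y' \<in> carrier N"
      then show ?thesis
        using h by (simp only: d3 mem_Times_iff fst_conv snd_conv N.M.a_closed simp_thms)
          (simp add: balanced_def additive_def Pi_iff cancel)
    next
      fix x a y assume "d = frag_of (ract M x a, y) - frag_of (x, a \<odot>\<^bsub>N\<^esub> y)"
        and xy: "x \<in> carrier M" "a \<in> carrier A" "y \<in> carrier N"
      then show ?thesis
        using h hc by (simp only: d2 mem_Times_iff fst_conv snd_conv M.r_closed N.l_closed simp_thms)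
          (simp add: balanced_def M.r_closed N.l_closed X.r_neg a_minus_def)
    qed
  qed
  then have "tensor_relators A M N \<subseteq> kernel FG (add_monoid X) ?F"
    using relators_carrier by (fastforce simp only: kernel_def monoid.simps intro: subsetD)
  then have "TS \<subseteq> kernel FG (add_monoid X) ?F"
    unfolding tensor_subgroup_def by (rule FG.generate_subgroup_incl[OF _ F.subgroup_kernel])
  then have ker: "?F d = \<zero>\<^bsub>X\<^esub>" "d \<in> carrier FG" if "d \<in> TS" for d
    using that by (auto simp: kernel_def)
  have Fc: "?F c \<in> carrier X" using F.hom_closed[OF c] by simp
  have "?F (d + c) = ?F c" if "d \<in> TS" for d
    using F.hom_mult[OF ker(2)[OF that] c] ker(1)[OF that] Fc by simp
  then have "?F ` (TS #>\<^bsub>FG\<^esub> c) = {?F c}"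
    using subgroup.one_closed[OF subgroup_TS] by (auto simp: r_coset_def image_iff)
  then show ?thesis
    by (simp add: tensor_lift_def)
qed

lemma tensor_lift_pure:
  assumes X: "abelian_group X" and h: "balanced A M N X h" and xy: "x \<in> carrier M" "y \<in> carrier N"
  shows "tensor_lift X h (pure x y) = h x y"
proof -
  interpret X: abelian_group X by fact
  show ?thesis
    using xy balanced_closed[OF h] by (simp add: pure_tensor_def tensor_lift_coset[OF X h] X.finsum_insert)
qed

lemma additive_tensor_lift:
  assumes X: "abelian_group X" and h: "balanced A M N X h"
  shows "additive MN X (tensor_lift X h)"
proof -
  let ?F = "\<lambda>c. \<Oplus>\<^bsub>X\<^esub> p \<in> Poly_Mapping.keys c. [Poly_Mapping.lookup c p] \<cdot>\<^bsub>X\<^esub> h (fst p) (snd p)"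
  have F: "?F \<in> hom FG (add_monoid X)"
    using finsum_frag_hom[OF X, of "carrier M \<times> carrier N" "\<lambda>p. h (fst p) (snd p)"]
      balanced_closed[OF h] by auto
  show ?thesis
  proof (rule additiveI)
    fix t assume "t \<in> carrier MN"
    then show "tensor_lift X h t \<in> carrier X"
      using hom_in_carrier[OF F] by (auto simp: carrier_MN RCOSETS_def tensor_lift_coset[OF X h])
  next
    fix t u assume "t \<in> carrier MN" "u \<in> carrier MN"
    then obtain c d where c: "c \<in> carrier FG" "t = TS #>\<^bsub>FG\<^esub> c" and d: "d \<in> carrier FG" "u = TS #>\<^bsub>FG\<^esub> d"
      by (auto simp: carrier_MN RCOSETS_def)
    have cd: "c + d \<in> carrier FG" using FG.m_closed[OF c(1) d(1)] .
    show "tensor_lift X h (t \<oplus>\<^bsub>MN\<^esub> u) = tensor_lift X h t \<oplus>\<^bsub>X\<^esub> tensor_lift X h u"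
      using hom_mult[OF F c(1) d(1)]
      by (simp only: c d coset_add tensor_lift_coset[OF X h] cd) simp
  qed
qed

text \<open>No cases for zero and negatives are required, since \<open>0 = 0 \<otimes> 0\<close> and
  \<open>-(x \<otimes> y) = (-x) \<otimes> y\<close> are themselves pure tensors.\<close>

lemma tensor_induct [consumes 1, case_names pure add]:
  assumes "t \<in> carrier MN"
    and P: "\<And>x y. \<lbrakk>x \<in> carrier M; y \<in> carrier N\<rbrakk> \<Longrightarrow> P (pure x y)"
    and add: "\<And>t u. \<lbrakk>t \<in> carrier MN; u \<in> carrier MN; P t; P u\<rbrakk> \<Longrightarrow> P (t \<oplus>\<^bsub>MN\<^esub> u)"
  shows "P t"
proof -
  obtain c where c: "c \<in> carrier FG" "t = TS #>\<^bsub>FG\<^esub> c"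
    using assms(1) by (auto simp: carrier_MN RCOSETS_def)
  have coset: "TS #>\<^bsub>FG\<^esub> c \<in> carrier MN" if "c \<in> carrier FG" for c
    using that by (auto simp: carrier_MN RCOSETS_def)
  have add': "P (TS #>\<^bsub>FG\<^esub> (c + d))"
    if "c \<in> carrier FG" "d \<in> carrier FG" "P (TS #>\<^bsub>FG\<^esub> c)" "P (TS #>\<^bsub>FG\<^esub> d)" for c d
    using add[OF coset[OF that(1)] coset[OF that(2)] that(3,4)] that(1,2) by (simp only: coset_add)
  have zero: "P (TS #>\<^bsub>FG\<^esub> 0)"
  proof -
    have "pure \<zero>\<^bsub>M\<^esub> \<zero>\<^bsub>N\<^esub> = \<zero>\<^bsub>MN\<^esub>"
      using pure_add_left[of "\<zero>\<^bsub>M\<^esub>" "\<zero>\<^bsub>M\<^esub>" "\<zero>\<^bsub>N\<^esub>"] pure_closed[of "\<zero>\<^bsub>M\<^esub>" "\<zero>\<^bsub>N\<^esub>"]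
      by (simp add: MN.add.l_cancel_one')
    moreover have "\<zero>\<^bsub>MN\<^esub> = TS #>\<^bsub>FG\<^esub> 0"
      using FG.coset_mult_one[of TS] subgroup.subset[OF subgroup_TS]
      by (simp add: tensor_def tensor_group_def Let_def FactGroup_def)
    ultimately show ?thesis using P[of "\<zero>\<^bsub>M\<^esub>" "\<zero>\<^bsub>N\<^esub>"] by simp
  qed
  have neg: "P (TS #>\<^bsub>FG\<^esub> (- frag_of p))" if p_in: "p \<in> carrier M \<times> carrier N" for p
  proof -
    obtain x y where p: "p = (x, y)" "x \<in> carrier M" "y \<in> carrier N" using p_in by auto
    have z: "pure \<zero>\<^bsub>M\<^esub> y = \<zero>\<^bsub>MN\<^esub>"
      using pure_add_left[of "\<zero>\<^bsub>M\<^esub>" "\<zero>\<^bsub>M\<^esub>" y] pure_closed[of "\<zero>\<^bsub>M\<^esub>" y] p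
      by (simp add: MN.add.l_cancel_one')
    have "pure (\<ominus>\<^bsub>M\<^esub> x) y \<oplus>\<^bsub>MN\<^esub> pure x y = \<zero>\<^bsub>MN\<^esub>"
      using p pure_add_left[of "\<ominus>\<^bsub>M\<^esub> x" x y] z by (simp add: M.M.l_neg)
    moreover have "(TS #>\<^bsub>FG\<^esub> (- frag_of p)) \<oplus>\<^bsub>MN\<^esub> pure x y = \<zero>\<^bsub>MN\<^esub>"
      using FG.coset_mult_one[of TS] subgroup.subset[OF subgroup_TS] that p
      by (simp add: pure_tensor_def coset_add keys_minus) (simp add: tensor_def tensor_group_def Let_def FactGroup_def)
    ultimately have "TS #>\<^bsub>FG\<^esub> (- frag_of p) = pure (\<ominus>\<^bsub>M\<^esub> x) y"
      using p that coset[of "- frag_of p"] pure_closed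
      by (metis M.M.a_inv_closed MN.minus_equality MN.minus_minus carrier_free_Abelian_group_iff frag_of_in_free_Abelian_group keys_minus)
    then show ?thesis using P[of "\<ominus>\<^bsub>M\<^esub> x" y] p by simp
  qed
  \<comment> \<open>Induction on the free abelian group proceeds through differences, while
    \<open>P\<close> is only known to be closed under sums. Carrying the claim for \<open>c\<close>
    and \<open>- c\<close> together makes the difference step a sum.\<close>
  have "Poly_Mapping.keys c \<subseteq> carrier M \<times> carrier N"
    using c(1) by simp
  then have "P (TS #>\<^bsub>FG\<^esub> c) \<and> P (TS #>\<^bsub>FG\<^esub> (- c))"
  proof (rule free_Abelian_group_induct)
    show "P (TS #>\<^bsub>FG\<^esub> 0) \<and> P (TS #>\<^bsub>FG\<^esub> (- 0))"
      using zero by simp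
  next
    fix c d
    assume "Poly_Mapping.keys c \<subseteq> carrier M \<times> carrier N" "Poly_Mapping.keys d \<subseteq> carrier M \<times> carrier N"
      "P (TS #>\<^bsub>FG\<^esub> c) \<and> P (TS #>\<^bsub>FG\<^esub> (- c))" "P (TS #>\<^bsub>FG\<^esub> d) \<and> P (TS #>\<^bsub>FG\<^esub> (- d))"
    then show "P (TS #>\<^bsub>FG\<^esub> (c - d)) \<and> P (TS #>\<^bsub>FG\<^esub> (- (c - d)))"
      using add'[of c "- d"] add'[of "- c" d] by (simp add: keys_minus)
  next
    fix p assume "p \<in> carrier M \<times> carrier N"
    then show "P (TS #>\<^bsub>FG\<^esub> frag_of p) \<and> P (TS #>\<^bsub>FG\<^esub> (- frag_of p))"
      using P neg by (cases p) (auto simp: pure_tensor_def)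
  qed
  then show ?thesis using c by simp
qed

lemma tensor_ext:
  assumes "additive MN X g" "additive MN X h"
    and "\<And>x y. \<lbrakk>x \<in> carrier M; y \<in> carrier N\<rbrakk> \<Longrightarrow> g (pure x y) = h (pure x y)"
    and "t \<in> carrier MN"
  shows "g t = h t"
  using assms(4) by (induction rule: tensor_induct) (simp_all add: assms(3) additive_add[OF assms(1)] additive_add[OF assms(2)])

end

section \<open>The bimodule structure on a tensor product\<close>

context tensor_pair
begin

lemma smult_lift:
  assumes "s \<in> carrier S"
  shows "additive MN MN (\<lambda>t. s \<odot>\<^bsub>MN\<^esub> t)"
    and "\<lbrakk>x \<in> carrier M; y \<in> carrier N\<rbrakk> \<Longrightarrow> s \<odot>\<^bsub>MN\<^esub> pure x y = pure (s \<odot>\<^bsub>M\<^esub> x) y"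
proof -
  \<comment> \<open>The target is \<open>tensor_group\<close>, because the actions on
    \<open>tensor\<close> are defined as lifts into it. Carrier, zero and addition are the same, so
    additivity transfers at once.\<close>
  have b: "balanced A M N (tensor_group A M N) (\<lambda>x y. pure (s \<odot>\<^bsub>M\<^esub> x) y)"
    using assms pure_closed[OF M.l_closed, OF assms] pure_add_left[OF M.l_closed M.l_closed, OF assms _ assms]
      pure_add_right[OF M.l_closed, OF assms] pure_balanced[OF M.l_closed, OF assms]
    by (intro balancedI) (simp_all add: tensor_def M.l_distr M.lr_assoc)
  show "additive MN MN (\<lambda>t. s \<odot>\<^bsub>MN\<^esub> t)"
    using additive_tensor_lift[OF abelian_tensor_group b] by (simp add: tensor_def additive_def)
  show "s \<odot>\<^bsub>MN\<^esub> pure x y = pure (s \<odot>\<^bsub>M\<^esub> x) y" if "x \<in> carrier M" "y \<in> carrier N"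
    using tensor_lift_pure[OF abelian_tensor_group b that] by (simp add: tensor_def)
qed

lemma ract_lift:
  assumes "b \<in> carrier T"
  shows "additive MN MN (\<lambda>t. ract MN t b)"
    and "\<lbrakk>x \<in> carrier M; y \<in> carrier N\<rbrakk> \<Longrightarrow> ract MN (pure x y) b = pure x (ract N y b)"
proof -
  have b: "balanced A M N (tensor_group A M N) (\<lambda>x y. pure x (ract N y b))"
    using assms pure_closed[OF _ N.r_closed, OF _ _ assms] pure_add_right[OF _ N.r_closed N.r_closed, OF _ _ assms _ assms]
      pure_add_left[OF _ _ N.r_closed, OF _ _ _ assms] pure_balanced[OF _ _ N.r_closed, OF _ _ _ assms]
    by (intro balancedI) (simp_all add: tensor_def N.r_distr N.lr_assoc)
  show "additive MN MN (\<lambda>t. ract MN t b)"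
    using additive_tensor_lift[OF abelian_tensor_group b] by (simp add: tensor_def additive_def)
  show "ract MN (pure x y) b = pure x (ract N y b)" if "x \<in> carrier M" "y \<in> carrier N"
    using tensor_lift_pure[OF abelian_tensor_group b that] by (simp add: tensor_def)
qed

lemmas smult_pure = smult_lift(2)
lemmas ract_pure = ract_lift(2)
lemmas smult_closed = additive_closed[OF smult_lift(1)]
lemmas ract_closed = additive_closed[OF ract_lift(1)]

lemma additive_sum:
  assumes "additive MN MN g" "additive MN MN h"
  shows "additive MN MN (\<lambda>t. g t \<oplus>\<^bsub>MN\<^esub> h t)"
  using assms by (auto simp: additive_def Pi_iff MN.a_ac)

text \<open>For fixed scalars each remaining axiom compares two additive maps of the tensor, so it
  can be checked on pure tensors, where it is an axiom of \<open>M\<close> or of \<open>N\<close>.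
  Closure under \<open>tensor\<close> is what allows tensor products to be iterated.\<close>

lemma bimod_MN: "bimod S T MN"
proof -
  note add = additive_add[OF smult_lift(1)] additive_add[OF ract_lift(1)]
  note simps = add smult_closed ract_closed smult_pure ract_pure pure_closed M.l_closed N.r_closed
  show ?thesis
  proof (intro bimod.intro bimod_axioms.intro M.A.ring_axioms N.B.ring_axioms abelian_MN)
    fix a a' t assume a: "a \<in> carrier S" "a' \<in> carrier S" and t: "t \<in> carrier MN"
    show "(a \<oplus>\<^bsub>S\<^esub> a') \<odot>\<^bsub>MN\<^esub> t = a \<odot>\<^bsub>MN\<^esub> t \<oplus>\<^bsub>MN\<^esub> a' \<odot>\<^bsub>MN\<^esub> t"
      using t by (rule tensor_ext[rotated -1])
        (use a in \<open>auto intro!: additive_sum smult_lift(1) simp: simps M.l_distr_scalar pure_add_left\<close>)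
    show "(a \<otimes>\<^bsub>S\<^esub> a') \<odot>\<^bsub>MN\<^esub> t = a \<odot>\<^bsub>MN\<^esub> (a' \<odot>\<^bsub>MN\<^esub> t)"
      using t by (rule tensor_ext[rotated -1])
        (use a in \<open>auto intro!: additive_comp[unfolded comp_def, OF smult_lift(1) smult_lift(1)] smult_lift(1)
          simp: simps M.l_assoc\<close>)
  next
    fix t b b' assume b: "b \<in> carrier T" "b' \<in> carrier T" and t: "t \<in> carrier MN"
    show "ract MN t (b \<oplus>\<^bsub>T\<^esub> b') = ract MN t b \<oplus>\<^bsub>MN\<^esub> ract MN t b'"
      using t by (rule tensor_ext[rotated -1])
        (use b in \<open>auto intro!: additive_sum ract_lift(1) simp: simps N.r_distr_scalar pure_add_right\<close>)
    show "ract MN t (b \<otimes>\<^bsub>T\<^esub> b') = ract MN (ract MN t b) b'"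
      using t by (rule tensor_ext[rotated -1])
        (use b in \<open>auto intro!: additive_comp[unfolded comp_def, OF ract_lift(1) ract_lift(1)] ract_lift(1)
          simp: simps N.r_assoc\<close>)
  next
    fix a b t assume a: "a \<in> carrier S" and b: "b \<in> carrier T" and t: "t \<in> carrier MN"
    show "ract MN (a \<odot>\<^bsub>MN\<^esub> t) b = a \<odot>\<^bsub>MN\<^esub> ract MN t b"
      using t by (rule tensor_ext[rotated -1])
        (use a b in \<open>auto intro!: additive_comp[unfolded comp_def, OF smult_lift(1) ract_lift(1)]
          additive_comp[unfolded comp_def, OF ract_lift(1) smult_lift(1)] simp: simps\<close>)
  next
    fix t assume t: "t \<in> carrier MN"
    have id: "additive MN MN (\<lambda>t. t)" by (simp add: additive_def)
    show "\<one>\<^bsub>S\<^esub> \<odot>\<^bsub>MN\<^esub> t = t"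
      using t by (rule tensor_ext[rotated -1]) (auto intro!: smult_lift(1) id simp: simps M.l_one)
    show "ract MN t \<one>\<^bsub>T\<^esub> = t"
      using t by (rule tensor_ext[rotated -1]) (auto intro!: ract_lift(1) id simp: simps N.r_one)
  qed (simp_all add: add smult_closed ract_closed)
qed

sublocale bimod_MN: bimod S T MN by (rule bimod_MN)

end

section \<open>Bimodule maps, functoriality and associativity of the tensor product\<close>

text \<open>Carrying the well-formedness of source and target along lets composites be typed by plain resolution.\<close>

definition bimap ::
    "('a, 'c) ring_scheme \<Rightarrow> ('b, 'd) ring_scheme \<Rightarrow> ('a, 'b, 'm) bimodule \<Rightarrow> ('a, 'b, 'n) bimodule \<Rightarrow>
     ('m \<Rightarrow> 'n) \<Rightarrow> bool"
  where "bimap A B M N h \<longleftrightarrow> bimod A B M \<and> bimod A B N \<and> h \<in> bimodule_hom A B M N"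

lemma bimapI:
  assumes "bimod A B M" "bimod A B N" "additive M N h"
    and "\<And>a x. \<lbrakk>a \<in> carrier A; x \<in> carrier M\<rbrakk> \<Longrightarrow> h (a \<odot>\<^bsub>M\<^esub> x) = a \<odot>\<^bsub>N\<^esub> h x"
    and "\<And>x b. \<lbrakk>x \<in> carrier M; b \<in> carrier B\<rbrakk> \<Longrightarrow> h (ract M x b) = ract N (h x) b"
  shows "bimap A B M N h"
  using assms by (auto simp: bimap_def bimodule_hom_def additive_def)

lemma bimapD:
  assumes "bimap A B M N h"
  shows "bimod A B M" "bimod A B N" "additive M N h"
    "x \<in> carrier M \<Longrightarrow> h x \<in> carrier N"
    "\<lbrakk>x \<in> carrier M; y \<in> carrier M\<rbrakk> \<Longrightarrow> h (x \<oplus>\<^bsub>M\<^esub> y) = h x \<oplus>\<^bsub>N\<^esub> h y"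
    "\<lbrakk>a \<in> carrier A; x \<in> carrier M\<rbrakk> \<Longrightarrow> h (a \<odot>\<^bsub>M\<^esub> x) = a \<odot>\<^bsub>N\<^esub> h x"
    "\<lbrakk>x \<in> carrier M; b \<in> carrier B\<rbrakk> \<Longrightarrow> h (ract M x b) = ract N (h x) b"
  using assms by (auto simp: bimap_def bimodule_hom_def additive_def)

lemma bimap_id: "bimod A B M \<Longrightarrow> bimap A B M M id"
  by (rule bimapI) (auto simp: additive_def)

lemma bimap_comp: "\<lbrakk>bimap A B L M g; bimap A B M N h\<rbrakk> \<Longrightarrow> bimap A B L N (h \<circ> g)"
  by (rule bimapI) (auto simp: bimapD intro: additive_comp dest: bimapD)

lemma bimod_tensor: "\<lbrakk>bimod S A M; bimod A T N\<rbrakk> \<Longrightarrow> bimod S T (tensor A M N)"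
  by (rule tensor_pair.bimod_MN) (rule tensor_pair.intro)

lemma (in tensor_pair) bimap_tensor_lift:
  assumes X: "bimod S T X" and h: "balanced A M N X h"
    and l: "\<And>s x y. \<lbrakk>s \<in> carrier S; x \<in> carrier M; y \<in> carrier N\<rbrakk> \<Longrightarrow> h (s \<odot>\<^bsub>M\<^esub> x) y = s \<odot>\<^bsub>X\<^esub> h x y"
    and r: "\<And>x y b. \<lbrakk>x \<in> carrier M; y \<in> carrier N; b \<in> carrier T\<rbrakk> \<Longrightarrow> h x (ract N y b) = ract X (h x y) b"
  shows "bimap S T MN X (tensor_lift X h)"
proof -
  interpret X: bimod S T X by fact
  note X' = X.M.abelian_group_axioms
  note lift = additive_tensor_lift[OF X' h]
  show ?thesis
  proof (rule bimapI[OF bimod_MN X lift])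
    fix s t assume s: "s \<in> carrier S" and t: "t \<in> carrier MN"
    have X_s: "additive X X (\<lambda>x. s \<odot>\<^bsub>X\<^esub> x)"
      using s by (intro additiveI) (auto simp: X.l_closed X.l_distr)
    show "tensor_lift X h (s \<odot>\<^bsub>MN\<^esub> t) = s \<odot>\<^bsub>X\<^esub> tensor_lift X h t"
      by (rule tensor_ext[OF additive_comp[unfolded comp_def, OF smult_lift(1) lift]
          additive_comp[unfolded comp_def, OF lift X_s]])
        (use s t in \<open>simp_all add: smult_pure tensor_lift_pure[OF X' h] M.l_closed l\<close>)
  next
    fix b t assume b: "b \<in> carrier T" and t: "t \<in> carrier MN"
    have X_b: "additive X X (\<lambda>x. ract X x b)"
      using b by (intro additiveI) (auto simp: X.r_closed X.r_distr)
    show "tensor_lift X h (ract MN t b) = ract X (tensor_lift X h t) b"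
      by (rule tensor_ext[OF additive_comp[unfolded comp_def, OF ract_lift(1) lift]
          additive_comp[unfolded comp_def, OF lift X_b]])
        (use b t in \<open>simp_all add: ract_pure tensor_lift_pure[OF X' h] N.r_closed r\<close>)
  qed
qed

text \<open>Right linearity of \<open>f\<close> and left linearity of \<open>g\<close> over
  \<open>A\<close> make \<open>(x, y) \<mapsto> f x \<otimes> g y\<close> balanced. Typing and value
  on pure tensors both rest on this one fact and are therefore proved together, a pattern repeated
  for the other structural maps.\<close>

lemma
  assumes f: "bimap S A M M' f" and g: "bimap A T N N' g"
  shows bimap_tensor_map: "bimap S T (tensor A M N) (tensor A M' N') (tensor_map A M' N' f g)"
    and tensor_map_pure: "\<lbrakk>x \<in> carrier M; y \<in> carrier N\<rbrakk> \<Longrightarrow>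
      tensor_map A M' N' f g (pure_tensor A M N x y) = pure_tensor A M' N' (f x) (g y)"
proof -
  interpret D: tensor_pair S A T M N using bimapD[OF f] bimapD[OF g] by (intro tensor_pair.intro)
  interpret C: tensor_pair S A T M' N' using bimapD[OF f] bimapD[OF g] by (intro tensor_pair.intro)
  have b: "balanced A M N C.MN (\<lambda>x y. C.pure (f x) (g y))"
    by (rule balancedI) (simp_all add: bimapD[OF f] bimapD[OF g] C.pure_closed C.pure_add_left C.pure_add_right C.pure_balanced)
  show "bimap S T (tensor A M N) (tensor A M' N') (tensor_map A M' N' f g)"
    unfolding tensor_map_def
    by (rule D.bimap_tensor_lift[OF C.bimod_MN b])
      (simp_all add: bimapD[OF f] bimapD[OF g] C.smult_pure C.ract_pure)
  show "tensor_map A M' N' f g (pure_tensor A M N x y) = pure_tensor A M' N' (f x) (g y)"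
    if "x \<in> carrier M" "y \<in> carrier N"
    unfolding tensor_map_def by (rule D.tensor_lift_pure[OF C.abelian_MN b that])
qed

text \<open>The map is a lift of lifts: for fixed \<open>z\<close> the inner lift takes care of
  additivity in \<open>u\<close>, and what remains for the outer lift, additivity in
  \<open>z\<close> and balance over \<open>B\<close>, is an identity between additive maps of
  \<open>u\<close> and can be tested on pure \<open>u\<close>.\<close>

lemma
  assumes L: "bimod S A L" and M: "bimod A B M" and N: "bimod B T N"
  shows bimap_assoc: "bimap S T (tensor B (tensor A L M) N) (tensor A L (tensor B M N)) (assoc A B L M N)"
    and assoc_pure: "\<lbrakk>x \<in> carrier L; y \<in> carrier M; z \<in> carrier N\<rbrakk> \<Longrightarrow>
      assoc A B L M N (pure_tensor B (tensor A L M) N (pure_tensor A L M x y) z) =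
      pure_tensor A L (tensor B M N) x (pure_tensor B M N y z)"
proof -
  interpret LM: tensor_pair S A B L M using L M by (intro tensor_pair.intro)
  interpret MN: tensor_pair A B T M N using M N by (intro tensor_pair.intro)
  interpret L_MN: tensor_pair S A T L MN.MN using L MN.bimod_MN by (intro tensor_pair.intro)
  interpret LM_N: tensor_pair S B T LM.MN N using N LM.bimod_MN by (intro tensor_pair.intro)
  let ?h = "\<lambda>z x y. L_MN.pure x (MN.pure y z)"
  let ?g = "\<lambda>u z. tensor_lift L_MN.MN (?h z) u"
  note simps = L_MN.pure_closed L_MN.pure_add_left L_MN.pure_add_right L_MN.pure_balanced
    L_MN.smult_pure L_MN.ract_pure MN.smult_pure MN.ract_pure
    MN.pure_closed MN.pure_add_left MN.pure_add_right MN.pure_balanced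
    LM.M.l_closed LM.M.r_closed LM.N.l_closed LM.N.r_closed MN.N.l_closed MN.N.r_closed
    LM.smult_pure LM.ract_pure LM.pure_closed LM.N.M.a_closed MN.N.M.a_closed LM.M.M.a_closed
  \<comment> \<open>Balance over \<open>A\<close> moves a scalar from \<open>x\<close> onto the
    whole tensor \<open>y \<otimes> z\<close>, so it has to be pulled out of the first factor there;
    hence the reversed use of \<open>MN.smult_pure\<close>.\<close>
  have b: "balanced A L M L_MN.MN (?h z)" if "z \<in> carrier N" for z
    using that by (intro balancedI) (simp_all add: simps flip: MN.smult_pure)
  note lift = LM.tensor_lift_pure[OF L_MN.abelian_MN b]
  note add = LM.additive_tensor_lift[OF L_MN.abelian_MN b]
  have g: "balanced B LM.MN N L_MN.MN ?g"
  proof (rule balancedI)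
    fix u z assume u: "u \<in> carrier LM.MN" and z: "z \<in> carrier N"
    then show "?g u z \<in> carrier L_MN.MN" by (intro additive_closed[OF add])
  next
    fix u u' z assume "u \<in> carrier LM.MN" "u' \<in> carrier LM.MN" and z: "z \<in> carrier N"
    then show "?g (u \<oplus>\<^bsub>LM.MN\<^esub> u') z = ?g u z \<oplus>\<^bsub>L_MN.MN\<^esub> ?g u' z" by (intro additive_add[OF add])
  next
    fix u z z' assume u: "u \<in> carrier LM.MN" and z: "z \<in> carrier N" "z' \<in> carrier N"
    have sum: "additive LM.MN L_MN.MN (\<lambda>u. ?g u z \<oplus>\<^bsub>L_MN.MN\<^esub> ?g u z')"
      using add[OF z(1)] add[OF z(2)] by (auto simp: additive_def Pi_iff L_MN.MN.a_ac)
    show "?g u (z \<oplus>\<^bsub>N\<^esub> z') = ?g u z \<oplus>\<^bsub>L_MN.MN\<^esub> ?g u z'"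
      by (rule LM.tensor_ext[OF add sum])
        (use z u  in \<open>simp_all add: lift simps\<close>)
  next
    fix u b' z assume u: "u \<in> carrier LM.MN" and b': "b' \<in> carrier B" and z: "z \<in> carrier N"
    show "?g (ract LM.MN u b') z = ?g u (b' \<odot>\<^bsub>N\<^esub> z)"
      by (rule LM.tensor_ext[OF additive_comp[unfolded comp_def, OF LM.ract_lift(1) add] add])
        (use u b' z in \<open>simp_all add: lift simps\<close>)
  qed
  show p: "assoc A B L M N (pure_tensor B (tensor A L M) N (pure_tensor A L M x y) z) =
      pure_tensor A L (tensor B M N) x (pure_tensor B M N y z)"
    if "x \<in> carrier L" "y \<in> carrier M" "z \<in> carrier N" for x y z
    unfolding assoc_def using that
    by (simp add: LM_N.tensor_lift_pure[OF L_MN.abelian_MN g] lift LM.pure_closed)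
  show "bimap S T (tensor B (tensor A L M) N) (tensor A L (tensor B M N)) (assoc A B L M N)"
    unfolding assoc_def
  proof (rule LM_N.bimap_tensor_lift[OF L_MN.bimod_MN g])
    fix s u z assume s: "s \<in> carrier S" and u: "u \<in> carrier LM.MN" and z: "z \<in> carrier N"
    show "?g (s \<odot>\<^bsub>LM.MN\<^esub> u) z = s \<odot>\<^bsub>L_MN.MN\<^esub> ?g u z"
      by (rule LM.tensor_ext[OF additive_comp[unfolded comp_def, OF LM.smult_lift(1) add]
          additive_comp[unfolded comp_def, OF add L_MN.smult_lift(1)]])
        (use s u z in \<open>simp_all add: lift simps\<close>)
  next
    fix u z b' assume u: "u \<in> carrier LM.MN" and z: "z \<in> carrier N" and b': "b' \<in> carrier T"
    show "?g u (ract N z b') = ract L_MN.MN (?g u z) b'"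
      by (rule LM.tensor_ext[OF add additive_comp[unfolded comp_def, OF add L_MN.ract_lift(1)]])
        (use b' u z in \<open>simp_all add: lift simps\<close>)
  qed
qed

text \<open>The mirror image of the previous argument: the inner lift now runs over \<open>v\<close>
  with \<open>x\<close> fixed, and additivity in \<open>x\<close> together with balance over
  \<open>A\<close> is tested on pure \<open>v\<close>.\<close>

lemma
  assumes L: "bimod S A L" and M: "bimod A B M" and N: "bimod B T N"
  shows bimap_assoc_inv: "bimap S T (tensor A L (tensor B M N)) (tensor B (tensor A L M) N) (assoc_inv A B L M N)"
    and assoc_inv_pure: "\<lbrakk>x \<in> carrier L; y \<in> carrier M; z \<in> carrier N\<rbrakk> \<Longrightarrow>
      assoc_inv A B L M N (pure_tensor A L (tensor B M N) x (pure_tensor B M N y z)) =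
      pure_tensor B (tensor A L M) N (pure_tensor A L M x y) z"
proof -
  interpret LM: tensor_pair S A B L M using L M by (intro tensor_pair.intro)
  interpret MN: tensor_pair A B T M N using M N by (intro tensor_pair.intro)
  interpret L_MN: tensor_pair S A T L MN.MN using L MN.bimod_MN by (intro tensor_pair.intro)
  interpret LM_N: tensor_pair S B T LM.MN N using N LM.bimod_MN by (intro tensor_pair.intro)
  let ?h = "\<lambda>x y z. LM_N.pure (LM.pure x y) z"
  let ?g = "\<lambda>x v. tensor_lift LM_N.MN (?h x) v"
  note simps = LM_N.pure_closed LM_N.pure_add_left LM_N.pure_add_right LM_N.pure_balanced
    LM_N.smult_pure LM_N.ract_pure LM.smult_pure LM.ract_pure
    LM.pure_closed LM.pure_add_left LM.pure_add_right LM.pure_balanced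
    LM.M.l_closed LM.M.r_closed LM.N.l_closed LM.N.r_closed MN.N.l_closed MN.N.r_closed
    MN.smult_pure MN.ract_pure MN.pure_closed LM.N.M.a_closed MN.N.M.a_closed LM.M.M.a_closed
  have b: "balanced B M N LM_N.MN (?h x)" if "x \<in> carrier L" for x
    using that by (intro balancedI) (simp_all add: simps flip: LM.ract_pure)
  note lift = MN.tensor_lift_pure[OF LM_N.abelian_MN b]
  note add = MN.additive_tensor_lift[OF LM_N.abelian_MN b]
  have g: "balanced A L MN.MN LM_N.MN ?g"
  proof (rule balancedI)
    fix x v assume "x \<in> carrier L" "v \<in> carrier MN.MN"
    then show "?g x v \<in> carrier LM_N.MN" by (intro additive_closed[OF add])
  next
    fix x v v' assume "x \<in> carrier L" "v \<in> carrier MN.MN" "v' \<in> carrier MN.MN"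
    then show "?g x (v \<oplus>\<^bsub>MN.MN\<^esub> v') = ?g x v \<oplus>\<^bsub>LM_N.MN\<^esub> ?g x v'" by (intro additive_add[OF add])
  next
    fix x x' v assume v: "v \<in> carrier MN.MN" and x: "x \<in> carrier L" "x' \<in> carrier L"
    have sum: "additive MN.MN LM_N.MN (\<lambda>v. ?g x v \<oplus>\<^bsub>LM_N.MN\<^esub> ?g x' v)"
      using add[OF x(1)] add[OF x(2)] by (auto simp: additive_def Pi_iff LM_N.MN.a_ac)
    show "?g (x \<oplus>\<^bsub>L\<^esub> x') v = ?g x v \<oplus>\<^bsub>LM_N.MN\<^esub> ?g x' v"
      by (rule MN.tensor_ext[OF add sum])
        (use x v  in \<open>simp_all add: lift simps\<close>)
  next
    fix x a v assume x: "x \<in> carrier L" and a: "a \<in> carrier A" and v: "v \<in> carrier MN.MN"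
    show "?g (ract L x a) v = ?g x (a \<odot>\<^bsub>MN.MN\<^esub> v)"
      by (rule MN.tensor_ext[OF add additive_comp[unfolded comp_def, OF MN.smult_lift(1) add]])
        (use x a v in \<open>simp_all add: lift simps\<close>)
  qed
  show p: "assoc_inv A B L M N (pure_tensor A L (tensor B M N) x (pure_tensor B M N y z)) =
      pure_tensor B (tensor A L M) N (pure_tensor A L M x y) z"
    if "x \<in> carrier L" "y \<in> carrier M" "z \<in> carrier N" for x y z
    unfolding assoc_inv_def using that
    by (simp add: L_MN.tensor_lift_pure[OF LM_N.abelian_MN g] lift MN.pure_closed)
  show "bimap S T (tensor A L (tensor B M N)) (tensor B (tensor A L M) N) (assoc_inv A B L M N)"
    unfolding assoc_inv_def
  proof (rule L_MN.bimap_tensor_lift[OF LM_N.bimod_MN g])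
    fix s x v assume s: "s \<in> carrier S" and x: "x \<in> carrier L" and v: "v \<in> carrier MN.MN"
    show "?g (s \<odot>\<^bsub>L\<^esub> x) v = s \<odot>\<^bsub>LM_N.MN\<^esub> ?g x v"
      by (rule MN.tensor_ext[OF add additive_comp[unfolded comp_def, OF add LM_N.smult_lift(1)]])
        (use s x v in \<open>simp_all add: lift simps\<close>)
  next
    fix x v b' assume x: "x \<in> carrier L" and v: "v \<in> carrier MN.MN" and b': "b' \<in> carrier T"
    show "?g x (ract MN.MN v b') = ract LM_N.MN (?g x v) b'"
      by (rule MN.tensor_ext[OF additive_comp[unfolded comp_def, OF MN.ract_lift(1) add]
          additive_comp[unfolded comp_def, OF add LM_N.ract_lift(1)]])
        (use b' x v in \<open>simp_all add: lift simps\<close>)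
  qed
qed

section \<open>Regular bimodules and the unit isomorphisms\<close>

text \<open>The operations agree as functions and not merely on the smaller carrier. This allows
  every operation in a tower to be rewritten into that of the top ring.\<close>

definition ring_ext :: "('a, 'c) ring_scheme \<Rightarrow> ('a, 'd) ring_scheme \<Rightarrow> bool"
  where "ring_ext A C \<longleftrightarrow> ring A \<and> ring C \<and> carrier A \<subseteq> carrier C \<and>
    ring.add A = ring.add C \<and> monoid.mult A = monoid.mult C \<and>
    \<zero>\<^bsub>A\<^esub> = \<zero>\<^bsub>C\<^esub> \<and> \<one>\<^bsub>A\<^esub> = \<one>\<^bsub>C\<^esub>"

lemma ring_ext_refl: "ring A \<Longrightarrow> ring_ext A A"
  by (simp add: ring_ext_def)

lemma regular_simps [simp]:
  "carrier (regular C) = carrier C" "ring.add (regular C) = ring.add C" "ring.zero (regular C) = ring.zero C"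
  "smult (regular C) = monoid.mult C" "ract (regular C) = monoid.mult C"
  by (simp_all add: regular_def)

lemma bimod_regular:
  assumes "ring_ext A C" "ring_ext B C"
  shows "bimod A B (regular C)"
proof -
  interpret A: ring A using assms by (simp add: ring_ext_def)
  interpret B: ring B using assms by (simp add: ring_ext_def)
  interpret C: ring C using assms by (simp add: ring_ext_def)
  have sub: "a \<in> carrier A \<Longrightarrow> a \<in> carrier C" "b \<in> carrier B \<Longrightarrow> b \<in> carrier C" for a b
    using assms by (auto simp: ring_ext_def)
  have eq: "ring.add A = ring.add C" "monoid.mult A = monoid.mult C" "\<one>\<^bsub>A\<^esub> = \<one>\<^bsub>C\<^esub>"
    "ring.add B = ring.add C" "monoid.mult B = monoid.mult C" "\<one>\<^bsub>B\<^esub> = \<one>\<^bsub>C\<^esub>"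
    using assms by (simp_all add: ring_ext_def)
  have "abelian_group (regular C)"
    by (rule abelian_groupI) (use abelian_groupE[OF C.abelian_group_axioms] in simp_all)
  then show ?thesis
    by (intro bimod.intro bimod_axioms.intro A.ring_axioms B.ring_axioms)
      (simp_all add: sub eq C.l_distr C.r_distr C.m_assoc)
qed

lemma bimod_regular_self: "ring A \<Longrightarrow> bimod A A (regular A)"
  by (intro bimod_regular ring_ext_refl)

lemma
  assumes M: "bimod A T M"
  shows bimap_lunit: "bimap A T (tensor A (regular A) M) M (lunit M)"
    and lunit_pure: "\<lbrakk>a \<in> carrier A; x \<in> carrier M\<rbrakk> \<Longrightarrow> lunit M (pure_tensor A (regular A) M a x) = a \<odot>\<^bsub>M\<^esub> x"
    and bimap_lunit_inv: "bimap A T M (tensor A (regular A) M) (lunit_inv A M)"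
proof -
  interpret M: bimod A T M by fact
  interpret AM: tensor_pair A A T "regular A" M
    using M bimod_regular_self[OF M.A.ring_axioms] by (intro tensor_pair.intro)
  have b: "balanced A (regular A) M M (\<lambda>a x. a \<odot>\<^bsub>M\<^esub> x)"
    by (rule balancedI) (simp_all add: M.l_closed M.l_distr M.l_distr_scalar M.l_assoc)
  show "bimap A T (tensor A (regular A) M) M (lunit M)"
    unfolding lunit_def by (rule AM.bimap_tensor_lift[OF M b]) (simp_all add: M.l_assoc M.lr_assoc)
  show "lunit M (pure_tensor A (regular A) M a x) = a \<odot>\<^bsub>M\<^esub> x" if "a \<in> carrier A" "x \<in> carrier M"
    unfolding lunit_def using that by (intro AM.tensor_lift_pure[OF M.M.abelian_group_axioms b]) simp_all
  show "bimap A T M (tensor A (regular A) M) (lunit_inv A M)"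
    unfolding lunit_inv_def
    \<comment> \<open>Left linearity is \<open>1 \<otimes> a x = a \<otimes> x\<close>: the scalar
      is carried back across the tensor sign onto the factor \<open>A\<close>.\<close>
    by (rule bimapI[OF M AM.bimod_MN], rule additiveI)
      (simp_all add: AM.pure_closed AM.pure_add_right AM.smult_pure AM.ract_pure flip: AM.pure_balanced)
qed

lemma
  assumes M: "bimod S A M"
  shows bimap_runit: "bimap S A (tensor A M (regular A)) M (runit M)"
    and runit_pure: "\<lbrakk>x \<in> carrier M; a \<in> carrier A\<rbrakk> \<Longrightarrow> runit M (pure_tensor A M (regular A) x a) = ract M x a"
    and bimap_runit_inv: "bimap S A M (tensor A M (regular A)) (runit_inv A M)"
proof -
  interpret M: bimod S A M by fact
  interpret MA: tensor_pair S A A M "regular A"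
    using M bimod_regular_self[OF M.B.ring_axioms] by (intro tensor_pair.intro)
  have b: "balanced A M (regular A) M (ract M)"
    by (rule balancedI) (simp_all add: M.r_closed M.r_distr M.r_distr_scalar M.r_assoc)
  show "bimap S A (tensor A M (regular A)) M (runit M)"
    unfolding runit_def by (rule MA.bimap_tensor_lift[OF M b]) (simp_all add: M.r_assoc M.lr_assoc)
  show "runit M (pure_tensor A M (regular A) x a) = ract M x a" if "x \<in> carrier M" "a \<in> carrier A"
    unfolding runit_def using that by (intro MA.tensor_lift_pure[OF M.M.abelian_group_axioms b]) simp_all
  show "bimap S A M (tensor A M (regular A)) (runit_inv A M)"
    unfolding runit_inv_def
    by (rule bimapI[OF M MA.bimod_MN], rule additiveI)
      (simp_all add: MA.pure_closed MA.pure_add_left MA.smult_pure MA.ract_pure MA.pure_balanced)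
qed

lemmas bimap_intros = bimap_comp bimap_tensor_map bimap_assoc bimap_assoc_inv bimap_id
  bimap_lunit bimap_lunit_inv bimap_runit bimap_runit_inv bimod_tensor bimod_regular_self

section \<open>Composite adjunctions and mates\<close>

lemma bimap_comp_unit:
  assumes "ring B" and F1: "bimod S B F1" and F2: "bimod B T F2" and G1: "bimod B S G1" and G2: "bimod T B G2"
    and \<eta>1: "bimap B B (regular B) (tensor S G1 F1) \<eta>1"
    and \<eta>2: "bimap T T (regular T) (tensor B G2 F2) \<eta>2"
  shows "bimap T T (regular T) (tensor S (tensor B G2 G1) (tensor B F1 F2)) (comp_unit S B F1 F2 G1 G2 \<eta>1 \<eta>2)"
  unfolding comp_unit_def by ((rule assms bimap_intros)+)

text \<open>The composite inserts \<open>\<eta>1 1\<close> between the two factors of each term of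
  \<open>\<eta>2 t\<close>. Arbitrary expansions are allowed, so that the inclusion unit, with one
  term, and the comultiplication, with one term per basis element, are both instances.\<close>

lemma comp_unit_finsum:
  assumes B: "ring B" and F1: "bimod S B F1" and F2: "bimod B T F2" and G1: "bimod B S G1" and G2: "bimod T B G2"
    and \<eta>1: "bimap B B (regular B) (tensor S G1 F1) \<eta>1"
    and xy: "x \<in> I \<rightarrow> carrier G2" "y \<in> I \<rightarrow> carrier F2"
      "\<eta>2 t = (\<Oplus>\<^bsub>tensor B G2 F2\<^esub> i \<in> I. pure_tensor B G2 F2 (x i) (y i))"
    and uv: "u \<in> J \<rightarrow> carrier G1" "v \<in> J \<rightarrow> carrier F1"
      "\<eta>1 \<one>\<^bsub>B\<^esub> = (\<Oplus>\<^bsub>tensor S G1 F1\<^esub> j \<in> J. pure_tensor S G1 F1 (u j) (v j))"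
  shows "comp_unit S B F1 F2 G1 G2 \<eta>1 \<eta>2 t =
    (\<Oplus>\<^bsub>tensor S (tensor B G2 G1) (tensor B F1 F2)\<^esub> i \<in> I. \<Oplus>\<^bsub>tensor S (tensor B G2 G1) (tensor B F1 F2)\<^esub> j \<in> J.
      pure_tensor S (tensor B G2 G1) (tensor B F1 F2)
        (pure_tensor B G2 G1 (x i) (u j)) (pure_tensor B F1 F2 (v j) (y i)))"
proof -
  interpret B: ring B by fact
  interpret G1F1: tensor_pair B S B G1 F1 using F1 G1 by (intro tensor_pair.intro)
  interpret G2F2: tensor_pair T B T G2 F2 using F2 G2 by (intro tensor_pair.intro)
  interpret G2G1: tensor_pair T B S G2 G1 using G1 G2 by (intro tensor_pair.intro)
  interpret F1F2: tensor_pair S B T F1 F2 using F1 F2 by (intro tensor_pair.intro)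
  interpret X: tensor_pair T S T G2G1.MN F1F2.MN
    using G2G1.bimod_MN F1F2.bimod_MN by (intro tensor_pair.intro)
  interpret X3: tensor_pair T B B G2 G1F1.MN
    using G2 G1F1.bimod_MN by (intro tensor_pair.intro)
  interpret X4: tensor_pair T S B G2G1.MN F1
    using F1 G2G1.bimod_MN by (intro tensor_pair.intro)
  interpret X5: tensor_pair T B T X4.MN F2
    using F2 X4.bimod_MN by (intro tensor_pair.intro)
  interpret X6: tensor_pair T B B G2 "regular B"
    using G2 bimod_regular_self[OF B] by (intro tensor_pair.intro)
  interpret X7: tensor_pair T B T X6.MN F2
    using F2 X6.bimod_MN by (intro tensor_pair.intro)
  let ?h1 = "tensor_map B X6.MN F2 (runit_inv B G2) id"
  let ?h2 = "tensor_map B X3.MN F2 (tensor_map B G2 G1F1.MN id \<eta>1) id"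
  let ?h3 = "tensor_map B X4.MN F2 (assoc_inv B S G2 G1 F1) id"
  let ?h4 = "assoc S B G2G1.MN F1 F2"
  \<comment> \<open>Everything that follows \<open>\<eta>2\<close>. It is additive, so the sum over
    \<open>I\<close> passes through and one pure tensor \<open>a \<otimes> b\<close> remains to be
    treated.\<close>
  let ?\<Phi> = "?h4 \<circ> ?h3 \<circ> ?h2 \<circ> ?h1"
  have \<Phi>: "bimap T T G2F2.MN X.MN ?\<Phi>"
    by ((rule assms bimap_intros)+)
  have \<Phi>_pure: "?\<Phi> (G2F2.pure a b) =
      (\<Oplus>\<^bsub>X.MN\<^esub> j \<in> J. X.pure (G2G1.pure a (u j)) (F1F2.pure (v j) b))"
    if a: "a \<in> carrier G2" and b: "b \<in> carrier F2" for a b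
  proof -
    have uv_closed: "(\<lambda>j. G1F1.pure (u j) (v j)) \<in> J \<rightarrow> carrier G1F1.MN"
      using uv(1,2) by (auto intro: G1F1.pure_closed)
    have h1: "?h1 (G2F2.pure a b) = X7.pure (X6.pure a \<one>\<^bsub>B\<^esub>) b"
      using tensor_map_pure[OF bimap_runit_inv[OF G2] bimap_id[OF F2] a b] by (simp add: runit_inv_def)
    have m: "bimap T B X6.MN X3.MN (tensor_map B G2 G1F1.MN id \<eta>1)"
      by ((rule assms bimap_intros)+)
    have h2: "?h2 (X7.pure (X6.pure a \<one>\<^bsub>B\<^esub>) b) = pure_tensor B X3.MN F2 (X3.pure a (\<eta>1 \<one>\<^bsub>B\<^esub>)) b"
      using tensor_map_pure[OF m bimap_id[OF F2], of "X6.pure a \<one>\<^bsub>B\<^esub>" b]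
        tensor_map_pure[OF bimap_id[OF G2] \<eta>1, of a "\<one>\<^bsub>B\<^esub>"] a b by (simp add: X6.pure_closed)
    have m3: "bimap T B X3.MN X4.MN (assoc_inv B S G2 G1 F1)"
      by ((rule assms bimap_intros)+)
    have h3: "?h3 (pure_tensor B X3.MN F2 (X3.pure a w) b) = X5.pure (assoc_inv B S G2 G1 F1 (X3.pure a w)) b"
      if "w \<in> carrier G1F1.MN" for w
      using tensor_map_pure[OF m3 bimap_id[OF F2], of "X3.pure a w" b] a b that by (simp add: X3.pure_closed)
    \<comment> \<open>With \<open>a\<close> and \<open>b\<close> fixed, this isolates the dependence
      on the inserted tensor \<open>w\<close>. Its additivity lets the sum over \<open>J\<close>
      out.\<close>
    let ?\<Psi> = "\<lambda>w. ?h4 (X5.pure (assoc_inv B S G2 G1 F1 (X3.pure a w)) b)"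
    have \<Psi>: "additive G1F1.MN X.MN ?\<Psi>"
    proof (rule additive_comp[unfolded comp_def, OF _ bimapD(3)[OF bimap_assoc[OF G2G1.bimod_MN F1 F2]]])
      show "additive G1F1.MN X5.MN (\<lambda>w. X5.pure (assoc_inv B S G2 G1 F1 (X3.pure a w)) b)"
        using a b bimapD(4,5)[OF m3]
        by (intro additiveI) (simp_all add: X3.pure_closed X3.pure_add_right X5.pure_closed X5.pure_add_left)
    qed
    have \<Psi>_pure: "?\<Psi> (G1F1.pure p q) = X.pure (G2G1.pure a p) (F1F2.pure q b)"
      if "p \<in> carrier G1" "q \<in> carrier F1" for p q
      using that a b assoc_pure[OF G2G1.bimod_MN F1 F2, of "G2G1.pure a p" q b]
      by (simp add: assoc_inv_pure[OF G2 G1 F1] G2G1.pure_closed)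
    have "?\<Phi> (G2F2.pure a b) = ?\<Psi> (\<eta>1 \<one>\<^bsub>B\<^esub>)"
      using bimapD(4)[OF \<eta>1, of "\<one>\<^bsub>B\<^esub>"] by (simp add: h1 h2 h3)
    also have "\<dots> = (\<Oplus>\<^bsub>X.MN\<^esub> j \<in> J. ?\<Psi> (G1F1.pure (u j) (v j)))"
      unfolding uv(3) by (rule additive_finsum[OF \<Psi> G1F1.abelian_MN X.abelian_MN uv_closed])
    also have "\<dots> = (\<Oplus>\<^bsub>X.MN\<^esub> j \<in> J. X.pure (G2G1.pure a (u j)) (F1F2.pure (v j) b))"
      using uv(1,2) a b
      by (intro X.MN.finsum_cong' refl)
        (auto simp: Pi_iff \<Psi>_pure intro!: X.pure_closed G2G1.pure_closed F1F2.pure_closed)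
    finally show ?thesis .
  qed
  have "comp_unit S B F1 F2 G1 G2 \<eta>1 \<eta>2 t = ?\<Phi> (\<eta>2 t)"
    by (simp add: comp_unit_def)
  also have "\<dots> = (\<Oplus>\<^bsub>X.MN\<^esub> i \<in> I. ?\<Phi> (G2F2.pure (x i) (y i)))"
    unfolding xy(3) by (rule additive_finsum[OF bimapD(3)[OF \<Phi>] G2F2.abelian_MN X.abelian_MN])
      (use xy in \<open>auto intro: G2F2.pure_closed\<close>)
  also have "\<dots> = (\<Oplus>\<^bsub>X.MN\<^esub> i \<in> I. \<Oplus>\<^bsub>X.MN\<^esub> j \<in> J. X.pure (G2G1.pure (x i) (u j)) (F1F2.pure (v j) (y i)))"
    using xy(1,2) uv(1,2) 
    by (intro X.MN.finsum_cong' refl)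
      (auto simp: Pi_iff \<Phi>_pure simp del: o_apply intro!: X.MN.finsum_closed X.pure_closed G2G1.pure_closed F1F2.pure_closed)
  finally show ?thesis .
qed

text \<open>Reassociation brings the two middle factors together for \<open>\<epsilon>2\<close>; the
  resulting element of \<open>B\<close> is absorbed into \<open>G1\<close> by \<open>lunit\<close>
  before \<open>\<epsilon>1\<close> is applied.\<close>

lemma
  assumes B: "ring B" and F1: "bimod S B F1" and F2: "bimod B T F2" and G1: "bimod B S G1" and G2: "bimod T B G2"
    and \<epsilon>1: "bimap S S (tensor B F1 G1) (regular S) \<epsilon>1"
    and \<epsilon>2: "bimap B B (tensor T F2 G2) (regular B) \<epsilon>2"
  shows bimap_comp_counit:
      "bimap S S (tensor T (tensor B F1 F2) (tensor B G2 G1)) (regular S) (comp_counit T B F1 F2 G1 G2 \<epsilon>1 \<epsilon>2)"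
    and comp_counit_pure: "\<lbrakk>x \<in> carrier F1; y \<in> carrier F2; z \<in> carrier G2; w \<in> carrier G1\<rbrakk> \<Longrightarrow>
      comp_counit T B F1 F2 G1 G2 \<epsilon>1 \<epsilon>2
        (pure_tensor T (tensor B F1 F2) (tensor B G2 G1) (pure_tensor B F1 F2 x y) (pure_tensor B G2 G1 z w)) =
      \<epsilon>1 (pure_tensor B F1 G1 x (\<epsilon>2 (pure_tensor T F2 G2 y z) \<odot>\<^bsub>G1\<^esub> w))"
proof -
  show "bimap S S (tensor T (tensor B F1 F2) (tensor B G2 G1)) (regular S) (comp_counit T B F1 F2 G1 G2 \<epsilon>1 \<epsilon>2)"
    unfolding comp_counit_def by ((rule assms bimap_intros)+)
  interpret B: ring B by fact
  interpret F2G2: tensor_pair B T B F2 G2 using F2 G2 by (intro tensor_pair.intro)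
  interpret G2G1: tensor_pair T B S G2 G1 using G1 G2 by (intro tensor_pair.intro)
  interpret F2G2_G1: tensor_pair B B S F2G2.MN G1 using F2G2.bimod_MN G1 by (intro tensor_pair.intro)
  interpret F2_G2G1: tensor_pair B T S F2 G2G1.MN using F2 G2G1.bimod_MN by (intro tensor_pair.intro)
  interpret BG1: tensor_pair B B S "regular B" G1 using G1 bimod_regular_self[OF B] by (intro tensor_pair.intro)
  assume x: "x \<in> carrier F1" and y: "y \<in> carrier F2" and z: "z \<in> carrier G2" and w: "w \<in> carrier G1"
  have \<epsilon>2c: "\<epsilon>2 (F2G2.pure y z) \<in> carrier B"
    using bimapD(4)[OF \<epsilon>2 F2G2.pure_closed[OF y z]] by simp
  have m1: "bimap B S F2_G2G1.MN F2G2_G1.MN (assoc_inv T B F2 G2 G1)"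
    by ((rule assms bimap_intros)+)
  have m2: "bimap B S F2G2_G1.MN BG1.MN (tensor_map B (regular B) G1 \<epsilon>2 id)"
    by ((rule assms bimap_intros)+)
  show "comp_counit T B F1 F2 G1 G2 \<epsilon>1 \<epsilon>2
        (pure_tensor T (tensor B F1 F2) (tensor B G2 G1) (pure_tensor B F1 F2 x y) (pure_tensor B G2 G1 z w)) =
      \<epsilon>1 (pure_tensor B F1 G1 x (\<epsilon>2 (pure_tensor T F2 G2 y z) \<odot>\<^bsub>G1\<^esub> w))"
    unfolding comp_counit_def
    using x y z w \<epsilon>2c
    by (simp add: assoc_pure[OF F1 F2 G2G1.bimod_MN] G2G1.pure_closed F2_G2G1.pure_closed
        tensor_map_pure[OF bimap_id[OF F1] m1] assoc_inv_pure[OF F2 G2 G1]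
        tensor_map_pure[OF bimap_id[OF F1] m2] F2G2_G1.pure_closed F2G2.pure_closed
        tensor_map_pure[OF \<epsilon>2 bimap_id[OF G1]] BG1.pure_closed
        tensor_map_pure[OF bimap_id[OF F1] bimap_lunit[OF G1]] lunit_pure[OF G1])
qed

text \<open>The formula is tailored to a unit whose value at 1 is one pure tensor, as happens for
  composites of inclusions; no summation is then involved.\<close>

lemma
  assumes S: "ring S" and T: "ring T" and P: "bimod S T P" and P': "bimod T S P'"
    and Q: "bimod S T Q" and Q': "bimod T S Q'"
    and \<eta>: "bimap T T (regular T) (tensor S P' P) \<eta>"
    and \<epsilon>: "bimap S S (tensor T Q Q') (regular S) \<epsilon>"
    and \<phi>: "bimap S T P Q \<phi>"
  shows bimap_mate_left: "bimap T S Q' P' (mate_left S T P P' Q Q' \<eta> \<epsilon> \<phi>)"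
    and mate_left_eq: "\<lbrakk>q \<in> carrier Q'; p' \<in> carrier P'; p \<in> carrier P; \<eta> \<one>\<^bsub>T\<^esub> = pure_tensor S P' P p' p\<rbrakk> \<Longrightarrow>
      mate_left S T P P' Q Q' \<eta> \<epsilon> \<phi> q = ract P' p' (\<epsilon> (pure_tensor T Q Q' (\<phi> p) q))"
proof -
  show "bimap T S Q' P' (mate_left S T P P' Q Q' \<eta> \<epsilon> \<phi>)"
    unfolding mate_left_def by ((rule assms bimap_intros)+)
  interpret T: ring T by fact
  interpret P'P: tensor_pair T S T P' P using P P' by (intro tensor_pair.intro)
  interpret P'Q: tensor_pair T S T P' Q using P' Q by (intro tensor_pair.intro)
  interpret QQ': tensor_pair S T S Q Q' using Q Q' by (intro tensor_pair.intro)
  assume q: "q \<in> carrier Q'" and p: "p' \<in> carrier P'" "p \<in> carrier P"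
    and \<eta>1: "\<eta> \<one>\<^bsub>T\<^esub> = pure_tensor S P' P p' p"
  have m1: "bimap T T P'P.MN P'Q.MN (tensor_map S P' Q id \<phi>)"
    by ((rule assms bimap_intros)+)
  have \<phi>p: "\<phi> p \<in> carrier Q" using bimapD(4)[OF \<phi>] p by simp
  have "\<epsilon> (pure_tensor T Q Q' (\<phi> p) q) \<in> carrier S"
    using bimapD(4)[OF \<epsilon> QQ'.pure_closed[OF \<phi>p q]] by simp
  then show "mate_left S T P P' Q Q' \<eta> \<epsilon> \<phi> q = ract P' p' (\<epsilon> (pure_tensor T Q Q' (\<phi> p) q))"
    unfolding mate_left_def using q p \<phi>p
    by (simp add: lunit_inv_def tensor_map_pure[OF \<eta> bimap_id[OF Q']] \<eta>1
        tensor_map_pure[OF m1 bimap_id[OF Q']] P'P.pure_closed tensor_map_pure[OF bimap_id[OF P'] \<phi>]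
        assoc_pure[OF P' Q Q'] tensor_map_pure[OF bimap_id[OF P'] \<epsilon>] QQ'.pure_closed runit_pure[OF P'])
qed

text \<open>The double sum is the shape in which the composite of two comultiplications arrives, one
  index for each step of the tower.\<close>

lemma
  assumes S: "ring S" and T: "ring T" and P: "bimod S T P" and P': "bimod T S P'"
    and Q: "bimod S T Q" and Q': "bimod T S Q'"
    and \<eta>: "bimap S S (regular S) (tensor T P P') \<eta>"
    and \<epsilon>: "bimap T T (tensor S Q' Q) (regular T) \<epsilon>"
    and \<phi>: "bimap S T P Q \<phi>"
  shows bimap_mate_right: "bimap T S Q' P' (mate_right S T P P' Q Q' \<eta> \<epsilon> \<phi>)"
    and mate_right_finsum: "\<lbrakk>q \<in> carrier Q';
        \<And>i j. \<lbrakk>i \<in> I; j \<in> J\<rbrakk> \<Longrightarrow> p i j \<in> carrier P; \<And>i j. \<lbrakk>i \<in> I; j \<in> J\<rbrakk> \<Longrightarrow> p' i j \<in> carrier P';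
        \<eta> \<one>\<^bsub>S\<^esub> = (\<Oplus>\<^bsub>tensor T P P'\<^esub> i \<in> I. \<Oplus>\<^bsub>tensor T P P'\<^esub> j \<in> J. pure_tensor T P P' (p i j) (p' i j))\<rbrakk> \<Longrightarrow>
      mate_right S T P P' Q Q' \<eta> \<epsilon> \<phi> q =
        (\<Oplus>\<^bsub>P'\<^esub> i \<in> I. \<Oplus>\<^bsub>P'\<^esub> j \<in> J. \<epsilon> (pure_tensor S Q' Q q (\<phi> (p i j))) \<odot>\<^bsub>P'\<^esub> p' i j)"
proof -
  show "bimap T S Q' P' (mate_right S T P P' Q Q' \<eta> \<epsilon> \<phi>)"
    unfolding mate_right_def by ((rule assms bimap_intros)+)
  interpret S: ring S by fact
  interpret P': bimod T S P' by fact
  interpret PP': tensor_pair S T S P P' using P P' by (intro tensor_pair.intro)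
  interpret QP': tensor_pair S T S Q P' using P' Q by (intro tensor_pair.intro)
  interpret Q'Q: tensor_pair T S T Q' Q using Q Q' by (intro tensor_pair.intro)
  interpret X: tensor_pair T S S Q' PP'.MN using Q' PP'.bimod_MN by (intro tensor_pair.intro)
  assume q: "q \<in> carrier Q'" and p: "\<And>i j. \<lbrakk>i \<in> I; j \<in> J\<rbrakk> \<Longrightarrow> p i j \<in> carrier P"
    "\<And>i j. \<lbrakk>i \<in> I; j \<in> J\<rbrakk> \<Longrightarrow> p' i j \<in> carrier P'"
    and \<eta>1: "\<eta> \<one>\<^bsub>S\<^esub> = (\<Oplus>\<^bsub>PP'.MN\<^esub> i \<in> I. \<Oplus>\<^bsub>PP'.MN\<^esub> j \<in> J. PP'.pure (p i j) (p' i j))"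
  have m1: "bimap S S PP'.MN QP'.MN (tensor_map T Q P' \<phi> id)"
    by ((rule assms bimap_intros)+)
  let ?\<Phi> = "lunit P' \<circ> tensor_map T (regular T) P' \<epsilon> id \<circ> assoc_inv S T Q' Q P' \<circ>
    tensor_map S Q' QP'.MN id (tensor_map T Q P' \<phi> id)"
  \<comment> \<open>The rest of the composite as a function of the unit's value alone, with
    \<open>q\<close> fixed. Being additive, it can be applied term by term, first to the outer and
    then to the inner sum.\<close>
  let ?\<Psi> = "\<lambda>w. ?\<Phi> (X.pure q w)"
  have \<Phi>: "bimap T S X.MN P' ?\<Phi>"
    by ((rule assms bimap_intros)+)
  have \<Psi>: "additive PP'.MN P' ?\<Psi>"
    using q bimapD(4,5)[OF \<Phi>] by (intro additiveI) (simp_all add: X.pure_closed X.pure_add_right)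
  have \<epsilon>c: "\<epsilon> (Q'Q.pure q (\<phi> a)) \<in> carrier T" if "a \<in> carrier P" for a
    using bimapD(4)[OF \<epsilon> Q'Q.pure_closed[OF q bimapD(4)[OF \<phi> that]]] by simp
  have \<Psi>_pure: "?\<Psi> (PP'.pure a b) = \<epsilon> (Q'Q.pure q (\<phi> a)) \<odot>\<^bsub>P'\<^esub> b"
    if "a \<in> carrier P" "b \<in> carrier P'" for a b
    using q that \<epsilon>c[OF that(1)]
    by (simp add: tensor_map_pure[OF bimap_id[OF Q'] m1] PP'.pure_closed tensor_map_pure[OF \<phi> bimap_id[OF P']]
        bimapD(4)[OF \<phi>] assoc_inv_pure[OF Q' Q P'] tensor_map_pure[OF \<epsilon> bimap_id[OF P']] Q'Q.pure_closed
        lunit_pure[OF P'])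
  have "mate_right S T P P' Q Q' \<eta> \<epsilon> \<phi> q = ?\<Psi> (\<eta> \<one>\<^bsub>S\<^esub>)"
    unfolding mate_right_def using q by (simp add: runit_inv_def tensor_map_pure[OF bimap_id[OF Q'] \<eta>])
  also have "\<dots> = (\<Oplus>\<^bsub>P'\<^esub> i \<in> I. ?\<Psi> (\<Oplus>\<^bsub>PP'.MN\<^esub> j \<in> J. PP'.pure (p i j) (p' i j)))"
    unfolding \<eta>1 by (rule additive_finsum[OF \<Psi> PP'.abelian_MN P'.M.abelian_group_axioms])
      (auto intro!: PP'.MN.finsum_closed PP'.pure_closed p)
  also have "\<dots> = (\<Oplus>\<^bsub>P'\<^esub> i \<in> I. \<Oplus>\<^bsub>P'\<^esub> j \<in> J. \<epsilon> (Q'Q.pure q (\<phi> (p i j))) \<odot>\<^bsub>P'\<^esub> p' i j)"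
  proof (intro P'.M.finsum_cong' refl)
    fix i assume i: "i \<in> I"
    have "?\<Psi> (\<Oplus>\<^bsub>PP'.MN\<^esub> j \<in> J. PP'.pure (p i j) (p' i j)) = (\<Oplus>\<^bsub>P'\<^esub> j \<in> J. ?\<Psi> (PP'.pure (p i j) (p' i j)))"
      by (rule additive_finsum[OF \<Psi> PP'.abelian_MN P'.M.abelian_group_axioms])
        (auto intro!: PP'.pure_closed p i)
    also have "\<dots> = (\<Oplus>\<^bsub>P'\<^esub> j \<in> J. \<epsilon> (Q'Q.pure q (\<phi> (p i j))) \<odot>\<^bsub>P'\<^esub> p' i j)"
      by (intro P'.M.finsum_cong' refl) (auto simp: \<Psi>_pure p i \<epsilon>c simp del: o_apply intro!: P'.l_closed)
    finally show "?\<Psi> (\<Oplus>\<^bsub>PP'.MN\<^esub> j \<in> J. PP'.pure (p i j) (p' i j)) =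
        (\<Oplus>\<^bsub>P'\<^esub> j \<in> J. \<epsilon> (Q'Q.pure q (\<phi> (p i j))) \<odot>\<^bsub>P'\<^esub> p' i j)" .
  qed (auto intro!: P'.M.finsum_closed P'.l_closed \<epsilon>c p)
  finally show "mate_right S T P P' Q Q' \<eta> \<epsilon> \<phi> q =
      (\<Oplus>\<^bsub>P'\<^esub> i \<in> I. \<Oplus>\<^bsub>P'\<^esub> j \<in> J. \<epsilon> (pure_tensor S Q' Q q (\<phi> (p i j))) \<odot>\<^bsub>P'\<^esub> p' i j)" .
qed

section \<open>The biadjunction of a Frobenius extension\<close>

lemma ring_ext_trans: "\<lbrakk>ring_ext A B; ring_ext B C\<rbrakk> \<Longrightarrow> ring_ext A C"
  by (auto simp: ring_ext_def)

lemma ring_extD: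
  assumes "ring_ext A C"
  shows "ring A" "ring C" "a \<in> carrier A \<Longrightarrow> a \<in> carrier C"
    "ring.add A = ring.add C" "monoid.mult A = monoid.mult C"
    "\<zero>\<^bsub>A\<^esub> = \<zero>\<^bsub>C\<^esub>" "\<one>\<^bsub>A\<^esub> = \<one>\<^bsub>C\<^esub>"
  using assms by (auto simp: ring_ext_def)

locale extension = C: cring C for A :: "('a, 'c) ring_scheme" and C :: "('a, 'd) ring_scheme" +
  assumes ext: "ring_ext A C"
begin

sublocale A: ring A by (rule ring_extD(1)[OF ext])

lemmas sub = ring_extD(3)[OF ext]
lemmas ops = ring_extD(4-7)[OF ext]

lemma bimod_AC: "bimod A C (regular C)"
  and bimod_CA: "bimod C A (regular C)" and bimod_CC: "bimod C C (regular C)"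
  and bimod_A: "bimod A A (regular A)"
  by (auto intro!: bimod_regular ext ring_ext_refl C.ring_axioms A.ring_axioms)

text \<open>\<open>IR\<close> is Ind followed by Res, tensored over \<open>A\<close>, where the
  comultiplication lives; \<open>RI\<close> below is Res followed by Ind, tensored over
  \<open>C\<close>, where the trace counit is defined.\<close>

sublocale IR: tensor_pair C A C "regular C" "regular C"
  using bimod_CA bimod_AC by (rule tensor_pair.intro)

sublocale RI: tensor_pair A C A "regular C" "regular C"
  using bimod_AC bimod_CA by (rule tensor_pair.intro)

lemmas IR_pure_add = IR.pure_add_left[simplified] IR.pure_add_right[simplified]
lemmas RI_pure_add = RI.pure_add_left[simplified] RI.pure_add_right[simplified]

lemma bimap_incl_unit: "bimap A A (regular A) (tensor C (Res C) (Ind C)) (incl_unit C)"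
  unfolding Res_def Ind_def incl_unit_def
proof (rule bimapI[OF bimod_A RI.bimod_MN], rule additiveI)
  \<comment> \<open>Right linearity uses that the tensor is taken over all of \<open>C\<close>:
    \<open>a b \<otimes> 1 = a \<otimes> b\<close>.\<close>
  fix a b assume "a \<in> carrier (regular A)" "b \<in> carrier A"
  then show "RI.pure (ract (regular A) a b) \<one>\<^bsub>C\<^esub> = ract RI.MN (RI.pure a \<one>\<^bsub>C\<^esub>) b"
    using RI.pure_balanced[of a b "\<one>\<^bsub>C\<^esub>"] by (simp add: sub ops RI.ract_pure)
qed (simp_all add: sub ops RI.pure_closed RI_pure_add RI.smult_pure)

lemma
  shows bimap_mult_counit: "bimap C C (tensor A (Ind C) (Res C)) (regular C) (mult_counit C)"
    and mult_counit_pure: "\<lbrakk>x \<in> carrier C; y \<in> carrier C\<rbrakk> \<Longrightarrow>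
      mult_counit C (pure_tensor A (Ind C) (Res C) x y) = x \<otimes>\<^bsub>C\<^esub> y"
proof -
  have b: "balanced A (regular C) (regular C) (regular C) (\<lambda>x y. x \<otimes>\<^bsub>C\<^esub> y)"
    by (rule balancedI) (simp_all add: sub C.l_distr C.r_distr C.m_assoc)
  show "bimap C C (tensor A (Ind C) (Res C)) (regular C) (mult_counit C)"
    unfolding mult_counit_def Ind_def Res_def
    by (rule IR.bimap_tensor_lift[OF bimod_CC b]) (simp_all add: C.m_assoc)
  show "mult_counit C (pure_tensor A (Ind C) (Res C) x y) = x \<otimes>\<^bsub>C\<^esub> y"
    if "x \<in> carrier C" "y \<in> carrier C"
    unfolding mult_counit_def Ind_def Res_def
    using that by (intro IR.tensor_lift_pure[OF bimod.axioms(3)[OF bimod_CC] b]) simp_all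
qed

lemma pure_finsum_left:
  "\<lbrakk>f \<in> I \<rightarrow> carrier C; y \<in> carrier C\<rbrakk> \<Longrightarrow> IR.pure (finsum C f I) y = (\<Oplus>\<^bsub>IR.MN\<^esub> i \<in> I. IR.pure (f i) y)"
  by (rule additive_finsum[OF _ C.abelian_group_axioms IR.abelian_MN])
    (auto simp: IR.pure_closed IR_pure_add intro!: additiveI)

lemma pure_finsum_right:
  "\<lbrakk>x \<in> carrier C; f \<in> I \<rightarrow> carrier C\<rbrakk> \<Longrightarrow> IR.pure x (finsum C f I) = (\<Oplus>\<^bsub>IR.MN\<^esub> i \<in> I. IR.pure x (f i))"
  by (rule additive_finsum[OF _ C.abelian_group_axioms IR.abelian_MN])
    (auto simp: IR.pure_closed IR_pure_add intro!: additiveI)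

end

locale frobenius = extension +
  fixes \<delta> :: "'a \<Rightarrow> 'a"
  assumes linear: "linear_over A C \<delta>" and ex_dual_bases: "\<exists>n x y. dual_bases A C \<delta> n x y"
begin

lemma \<delta>_closed [simp]: "x \<in> carrier C \<Longrightarrow> \<delta> x \<in> carrier A"
  and \<delta>_add: "\<lbrakk>x \<in> carrier C; y \<in> carrier C\<rbrakk> \<Longrightarrow> \<delta> (x \<oplus>\<^bsub>C\<^esub> y) = \<delta> x \<oplus>\<^bsub>C\<^esub> \<delta> y"
  and \<delta>_left: "\<lbrakk>a \<in> carrier A; x \<in> carrier C\<rbrakk> \<Longrightarrow> \<delta> (a \<otimes>\<^bsub>C\<^esub> x) = a \<otimes>\<^bsub>C\<^esub> \<delta> x"
  using linear by (auto simp: linear_over_def ops)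

lemma \<delta>_right: "\<lbrakk>x \<in> carrier C; a \<in> carrier A\<rbrakk> \<Longrightarrow> \<delta> (x \<otimes>\<^bsub>C\<^esub> a) = \<delta> x \<otimes>\<^bsub>C\<^esub> a"
  using \<delta>_left[of a x] by (simp add: sub C.m_comm)

lemma
  shows bimap_trace_counit: "bimap A A (tensor C (Res C) (Ind C)) (regular A) (trace_counit A C \<delta>)"
    and trace_counit_pure: "\<lbrakk>x \<in> carrier C; y \<in> carrier C\<rbrakk> \<Longrightarrow>
      trace_counit A C \<delta> (pure_tensor C (Res C) (Ind C) x y) = \<delta> (x \<otimes>\<^bsub>C\<^esub> y)"
proof -
  have b: "balanced C (regular C) (regular C) (regular A) (\<lambda>x y. \<delta> (x \<otimes>\<^bsub>C\<^esub> y))"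
    by (rule balancedI) (simp_all add: ops \<delta>_add C.l_distr C.r_distr C.m_assoc)
  show "bimap A A (tensor C (Res C) (Ind C)) (regular A) (trace_counit A C \<delta>)"
    unfolding trace_counit_def Ind_def Res_def
    by (rule RI.bimap_tensor_lift[OF bimod_A b])
      (simp_all add: sub ops C.m_assoc \<delta>_left flip: \<delta>_right)
  show "trace_counit A C \<delta> (pure_tensor C (Res C) (Ind C) x y) = \<delta> (x \<otimes>\<^bsub>C\<^esub> y)"
    if "x \<in> carrier C" "y \<in> carrier C"
    unfolding trace_counit_def Ind_def Res_def
    using that by (intro RI.tensor_lift_pure[OF bimod.axioms(3)[OF bimod_A] b]) simp_all
qed

lemma dual_bases_closed:
  assumes "dual_bases A C \<delta> n x y" "i < n"
  shows "x i \<in> carrier C" "y i \<in> carrier C"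
  using assms by (auto simp: dual_bases_def finite_basis_def)

text \<open>Commutativity of \<open>C\<close> makes the pairing given by the trace symmetric, so
  each expansion formula is also available with the bases exchanged.\<close>

lemma dual_bases_sym: "dual_bases A C \<delta> n x y \<Longrightarrow> dual_bases A C \<delta> n y x"
  using dual_bases_closed[of n x y]
  by (auto simp: dual_bases_def C.m_comm[of "y _" "x _"])

text \<open>The coefficients of \<open>z\<close> in the basis \<open>y\<close> are read off by
  pairing with \<open>x\<close>: apply \<open>\<delta>(_ x\<^sub>i)\<close> to any expansion, pull
  the coefficients out by linearity over \<open>A\<close>, and duality leaves only the one with
  index \<open>i\<close>.\<close>

lemma dual_bases_expand:
  assumes xy: "dual_bases A C \<delta> n x y" and z: "z \<in> carrier C"
  shows "z = (\<Oplus>\<^bsub>C\<^esub> i \<in> {..<n}. \<delta> (z \<otimes>\<^bsub>C\<^esub> x i) \<otimes>\<^bsub>C\<^esub> y i)"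
proof -
  note xy_closed = dual_bases_closed[OF xy]
  obtain a where a: "a \<in> {..<n} \<rightarrow> carrier A" and z_eq: "z = (\<Oplus>\<^bsub>C\<^esub> i \<in> {..<n}. a i \<otimes>\<^bsub>C\<^esub> y i)"
    using xy z by (auto simp: dual_bases_def finite_basis_def)
  have a_closed: "a k \<in> carrier A" "a k \<in> carrier C" if "k < n" for k
    using a that by (auto intro: sub)
  have "\<delta> (z \<otimes>\<^bsub>C\<^esub> x i) = a i" if i: "i < n" for i
  proof -
    have add: "additive C A (\<lambda>z. \<delta> (z \<otimes>\<^bsub>C\<^esub> x i))"
      using xy_closed[OF i] by (intro additiveI) (simp_all add: \<delta>_add C.l_distr ops)
    have "\<delta> (z \<otimes>\<^bsub>C\<^esub> x i) = (\<Oplus>\<^bsub>A\<^esub> k \<in> {..<n}. \<delta> (a k \<otimes>\<^bsub>C\<^esub> y k \<otimes>\<^bsub>C\<^esub> x i))"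
      unfolding z_eq
      by (rule additive_finsum[OF add C.abelian_group_axioms A.abelian_group_axioms])
        (auto intro!: C.m_closed a_closed xy_closed)
    also have "\<dots> = (\<Oplus>\<^bsub>A\<^esub> k \<in> {..<n}. if i = k then a k else \<zero>\<^bsub>A\<^esub>)"
    proof (rule A.finsum_cong')
      fix k assume "k \<in> {..<n}"
      then have k: "k < n" by simp
      have "\<delta> (a k \<otimes>\<^bsub>C\<^esub> y k \<otimes>\<^bsub>C\<^esub> x i) = a k \<otimes>\<^bsub>C\<^esub> \<delta> (x i \<otimes>\<^bsub>C\<^esub> y k)"
        using k i by (simp add: C.m_assoc a_closed xy_closed \<delta>_left C.m_comm[of "y k"])
      then show "\<delta> (a k \<otimes>\<^bsub>C\<^esub> y k \<otimes>\<^bsub>C\<^esub> x i) = (if i = k then a k else \<zero>\<^bsub>A\<^esub>)"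
        using xy k i a_closed[OF k] by (simp add: dual_bases_def ops)
    qed (auto intro!: a_closed)
    also have "\<dots> = a i"
      using i by (intro A.finsum_singleton) (auto intro!: a_closed)
    finally show ?thesis .
  qed
  then show ?thesis
    unfolding z_eq[symmetric]
    by (subst z_eq, intro C.finsum_cong' refl) (auto intro!: C.m_closed a_closed xy_closed)
qed

text \<open>
  Expanding the \<open>y\<^sub>i\<close> in the basis \<open>y'\<close>, moving the coefficients in \<open>A\<close> across the tensor sign and
  contracting the expansion of \<open>x'\<^sub>j b\<close> in the basis \<open>x\<close>. The case \<open>b = 1\<close> is independence of the
  dual bases; the case of equal bases is centrality of \<open>\<Sum>\<^sub>i x\<^sub>i \<otimes> y\<^sub>i\<close>.
\<close>

lemma dual_bases_central:
  assumes xy: "dual_bases A C \<delta> n x y" and xy': "dual_bases A C \<delta> n' x' y'" and b: "b \<in> carrier C"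
  shows "(\<Oplus>\<^bsub>IR.MN\<^esub> i \<in> {..<n}. IR.pure (x i) (y i \<otimes>\<^bsub>C\<^esub> b)) = (\<Oplus>\<^bsub>IR.MN\<^esub> j \<in> {..<n'}. IR.pure (b \<otimes>\<^bsub>C\<^esub> x' j) (y' j))"
proof -
  note closed = dual_bases_closed[OF xy] dual_bases_closed[OF xy'] b
  let ?c = "\<lambda>i j. \<delta> (y i \<otimes>\<^bsub>C\<^esub> b \<otimes>\<^bsub>C\<^esub> x' j)"
  have c: "?c i j \<in> carrier A" "?c i j \<in> carrier C" if "i < n" "j < n'" for i j
    using that by (auto simp: closed intro!: sub)
  have "(\<Oplus>\<^bsub>IR.MN\<^esub> i \<in> {..<n}. IR.pure (x i) (y i \<otimes>\<^bsub>C\<^esub> b)) =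
      (\<Oplus>\<^bsub>IR.MN\<^esub> i \<in> {..<n}. \<Oplus>\<^bsub>IR.MN\<^esub> j \<in> {..<n'}. IR.pure (?c i j \<otimes>\<^bsub>C\<^esub> x i) (y' j))"
  proof (intro IR.MN.finsum_cong' refl)
    fix i assume "i \<in> {..<n}"
    then have i: "i < n" by simp
    have "IR.pure (x i) (y i \<otimes>\<^bsub>C\<^esub> b) = IR.pure (x i) (\<Oplus>\<^bsub>C\<^esub> j \<in> {..<n'}. ?c i j \<otimes>\<^bsub>C\<^esub> y' j)"
      using dual_bases_expand[OF xy', of "y i \<otimes>\<^bsub>C\<^esub> b"] i by (simp add: closed)
    also have "\<dots> = (\<Oplus>\<^bsub>IR.MN\<^esub> j \<in> {..<n'}. IR.pure (x i) (?c i j \<otimes>\<^bsub>C\<^esub> y' j))"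
      using i by (intro pure_finsum_right) (auto simp: closed intro!: C.m_closed c)
    also have "\<dots> = (\<Oplus>\<^bsub>IR.MN\<^esub> j \<in> {..<n'}. IR.pure (?c i j \<otimes>\<^bsub>C\<^esub> x i) (y' j))"
    proof (intro IR.MN.finsum_cong' refl)
      fix j assume "j \<in> {..<n'}"
      then show "IR.pure (x i) (?c i j \<otimes>\<^bsub>C\<^esub> y' j) = IR.pure (?c i j \<otimes>\<^bsub>C\<^esub> x i) (y' j)"
        using IR.pure_balanced[of "x i" "?c i j" "y' j"] i
        by (simp add: closed c C.m_comm[of "x i"])
    qed (use i in \<open>auto simp: closed c intro!: IR.pure_closed\<close>)
    finally show "IR.pure (x i) (y i \<otimes>\<^bsub>C\<^esub> b) = (\<Oplus>\<^bsub>IR.MN\<^esub> j \<in> {..<n'}. IR.pure (?c i j \<otimes>\<^bsub>C\<^esub> x i) (y' j))" .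
  qed (auto simp: closed c intro!: IR.MN.finsum_closed IR.pure_closed)
  also have "\<dots> = (\<Oplus>\<^bsub>IR.MN\<^esub> j \<in> {..<n'}. \<Oplus>\<^bsub>IR.MN\<^esub> i \<in> {..<n}. IR.pure (?c i j \<otimes>\<^bsub>C\<^esub> x i) (y' j))"
    by (rule IR.MN.finsum_swap) (auto simp: closed c intro!: IR.pure_closed)
  also have "\<dots> = (\<Oplus>\<^bsub>IR.MN\<^esub> j \<in> {..<n'}. IR.pure (b \<otimes>\<^bsub>C\<^esub> x' j) (y' j))"
  proof (intro IR.MN.finsum_cong' refl)
    fix j assume "j \<in> {..<n'}"
    then have j: "j < n'" by simp
    have "b \<otimes>\<^bsub>C\<^esub> x' j = (\<Oplus>\<^bsub>C\<^esub> i \<in> {..<n}. \<delta> (b \<otimes>\<^bsub>C\<^esub> x' j \<otimes>\<^bsub>C\<^esub> y i) \<otimes>\<^bsub>C\<^esub> x i)"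
      using dual_bases_expand[OF dual_bases_sym[OF xy], of "b \<otimes>\<^bsub>C\<^esub> x' j"] j by (simp add: closed)
    also have "\<dots> = (\<Oplus>\<^bsub>C\<^esub> i \<in> {..<n}. ?c i j \<otimes>\<^bsub>C\<^esub> x i)"
      using j by (intro C.finsum_cong' refl) (auto simp: closed c C.m_assoc C.m_comm[of "y _"] intro!: C.m_closed sub[OF \<delta>_closed])
    finally have "IR.pure (b \<otimes>\<^bsub>C\<^esub> x' j) (y' j) = IR.pure (\<Oplus>\<^bsub>C\<^esub> i \<in> {..<n}. ?c i j \<otimes>\<^bsub>C\<^esub> x i) (y' j)"
      by simp
    also have "\<dots> = (\<Oplus>\<^bsub>IR.MN\<^esub> i \<in> {..<n}. IR.pure (?c i j \<otimes>\<^bsub>C\<^esub> x i) (y' j))"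
      using j by (intro pure_finsum_left) (auto simp: closed intro!: C.m_closed c)
    finally show "(\<Oplus>\<^bsub>IR.MN\<^esub> i \<in> {..<n}. IR.pure (?c i j \<otimes>\<^bsub>C\<^esub> x i) (y' j)) = IR.pure (b \<otimes>\<^bsub>C\<^esub> x' j) (y' j)" ..
  qed (auto simp: closed c intro!: IR.pure_closed)
  finally show ?thesis .
qed

text \<open>This frees the comultiplication from its definite description, so that it can be
  computed with whichever dual bases are at hand. Uniqueness is \<open>dual_bases_central\<close> at
  \<open>b = 1\<close>.\<close>

lemma comult_one_eq:
  assumes xy: "dual_bases A C \<delta> n x y"
  shows "comult_one A C \<delta> = (\<Oplus>\<^bsub>IR.MN\<^esub> i \<in> {..<n}. IR.pure (x i) (y i))"
proof -
  have unique: "(\<Oplus>\<^bsub>IR.MN\<^esub> i \<in> {..<n'}. IR.pure (x' i) (y' i)) = (\<Oplus>\<^bsub>IR.MN\<^esub> i \<in> {..<n}. IR.pure (x i) (y i))"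
    if xy': "dual_bases A C \<delta> n' x' y'" for n' x' y'
  proof -
    have "(\<Oplus>\<^bsub>IR.MN\<^esub> i \<in> {..<n'}. IR.pure (x' i) (y' i)) = (\<Oplus>\<^bsub>IR.MN\<^esub> i \<in> {..<n'}. IR.pure (x' i) (y' i \<otimes>\<^bsub>C\<^esub> \<one>\<^bsub>C\<^esub>))"
      by (intro IR.MN.finsum_cong' refl) (auto simp: dual_bases_closed[OF xy'] intro!: IR.pure_closed)
    also have "\<dots> = (\<Oplus>\<^bsub>IR.MN\<^esub> i \<in> {..<n}. IR.pure (\<one>\<^bsub>C\<^esub> \<otimes>\<^bsub>C\<^esub> x i) (y i))"
      by (rule dual_bases_central[OF xy' xy]) simp
    also have "\<dots> = (\<Oplus>\<^bsub>IR.MN\<^esub> i \<in> {..<n}. IR.pure (x i) (y i))"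
      by (intro IR.MN.finsum_cong' refl) (auto simp: dual_bases_closed[OF xy] intro!: IR.pure_closed)
    finally show ?thesis .
  qed
  show ?thesis
    unfolding comult_one_def Ind_def Res_def
    by (rule the_equality) (use xy unique in blast)+
qed

text \<open>Left linearity comes from defining the map by the left action on the value at 1. Right
  linearity is the substantial part: it says that this value is central, which is
  \<open>dual_bases_central\<close> for two equal pairs of bases.\<close>

lemma bimap_comult_unit: "bimap C C (regular C) (tensor A (Ind C) (Res C)) (comult_unit A C \<delta>)"
  unfolding Ind_def Res_def
proof -
  obtain n x y where xy: "dual_bases A C \<delta> n x y" using ex_dual_bases by blast
  note closed = dual_bases_closed[OF xy]
  have one_closed: "comult_one A C \<delta> \<in> carrier IR.MN"
    unfolding comult_one_eq[OF xy] by (auto simp: closed intro!: IR.MN.finsum_closed IR.pure_closed)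
  have l: "b \<odot>\<^bsub>IR.MN\<^esub> comult_one A C \<delta> = (\<Oplus>\<^bsub>IR.MN\<^esub> i \<in> {..<n}. IR.pure (b \<otimes>\<^bsub>C\<^esub> x i) (y i))"
    if "b \<in> carrier C" for b
  proof -
    have "b \<odot>\<^bsub>IR.MN\<^esub> comult_one A C \<delta> = (\<Oplus>\<^bsub>IR.MN\<^esub> i \<in> {..<n}. b \<odot>\<^bsub>IR.MN\<^esub> IR.pure (x i) (y i))"
      unfolding comult_one_eq[OF xy]
      by (rule additive_finsum[OF IR.smult_lift(1)[OF that] IR.abelian_MN IR.abelian_MN])
        (auto simp: closed intro!: IR.pure_closed)
    then show ?thesis
      using that by (simp add: IR.smult_pure closed cong: IR.MN.finsum_cong')
        (intro IR.MN.finsum_cong' refl, auto simp: IR.smult_pure closed intro!: IR.pure_closed)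
  qed
  have r: "ract IR.MN (comult_one A C \<delta>) b = (\<Oplus>\<^bsub>IR.MN\<^esub> i \<in> {..<n}. IR.pure (x i) (y i \<otimes>\<^bsub>C\<^esub> b))"
    if "b \<in> carrier C" for b
  proof -
    have "ract IR.MN (comult_one A C \<delta>) b = (\<Oplus>\<^bsub>IR.MN\<^esub> i \<in> {..<n}. ract IR.MN (IR.pure (x i) (y i)) b)"
      unfolding comult_one_eq[OF xy]
      by (rule additive_finsum[OF IR.ract_lift(1)[OF that] IR.abelian_MN IR.abelian_MN])
        (auto simp: closed intro!: IR.pure_closed)
    then show ?thesis
      using that by simp
        (intro IR.MN.finsum_cong' refl, auto simp: IR.ract_pure closed intro!: IR.pure_closed)
  qed
  have central: "ract IR.MN (comult_one A C \<delta>) b = b \<odot>\<^bsub>IR.MN\<^esub> comult_one A C \<delta>" if "b \<in> carrier C" for b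
    using dual_bases_central[OF xy xy that] that by (simp add: l r)
  show "bimap C C (regular C) IR.MN (comult_unit A C \<delta>)"
    unfolding comult_unit_def Ind_def Res_def
    by (rule bimapI[OF bimod_CC IR.bimod_MN], rule additiveI)
      (simp_all add: one_closed IR.smult_closed IR.bimod_MN.l_distr_scalar IR.bimod_MN.l_assoc
        IR.bimod_MN.lr_assoc central)
qed

lemma comult_unit_one:
  assumes "dual_bases A C \<delta> n x y"
  shows "comult_unit A C \<delta> \<one>\<^bsub>C\<^esub> = (\<Oplus>\<^bsub>tensor A (Ind C) (Res C)\<^esub> i \<in> {..<n}. pure_tensor A (Ind C) (Res C) (x i) (y i))"
  unfolding comult_unit_def Ind_def Res_def comult_one_eq[OF assms]
  by (rule IR.bimod_MN.l_one) (auto simp: dual_bases_closed[OF assms] intro!: IR.MN.finsum_closed IR.pure_closed)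

end

section \<open>Towers and squares\<close>

text \<open>Both round trips are additive, so it is enough that they fix pure tensors.\<close>

lemma (in tensor_pair) bij_betw_tensorI:
  assumes N: "tensor_pair S' A' T' M' N'"
    and h: "additive MN (tensor A' M' N') h" and g: "additive (tensor A' M' N') MN g"
    and gh: "\<And>x y. \<lbrakk>x \<in> carrier M; y \<in> carrier N\<rbrakk> \<Longrightarrow> g (h (pure x y)) = pure x y"
    and hg: "\<And>x y. \<lbrakk>x \<in> carrier M'; y \<in> carrier N'\<rbrakk> \<Longrightarrow> h (g (pure_tensor A' M' N' x y)) = pure_tensor A' M' N' x y"
  shows "bij_betw h (carrier MN) (carrier (tensor A' M' N'))"
proof -
  have id: "additive X X (\<lambda>t. t)" for X :: "('u, 'v) ring_scheme" by (simp add: additive_def)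
  show ?thesis
  proof (rule bij_betw_byWitness[where f' = g])
    show "\<forall>t \<in> carrier MN. g (h t) = t"
      using tensor_ext[OF additive_comp[unfolded comp_def, OF h g] id] gh by blast
    show "\<forall>t \<in> carrier (tensor A' M' N'). h (g t) = t"
      using tensor_pair.tensor_ext[OF N additive_comp[unfolded comp_def, OF g h] id] hg by blast
  qed (use h g in \<open>auto simp: additive_def\<close>)
qed

locale tower = TB: extension T B + BR: extension B R
  for T :: "('a, 'c) ring_scheme" and B :: "('a, 'd) ring_scheme" and R :: "('a, 'e) ring_scheme"
begin

lemma ring_ext_TR: "ring_ext T R" by (rule ring_ext_trans[OF TB.ext BR.ext])

sublocale TR: extension T R by unfold_locales (rule ring_ext_TR)

lemmas ops = BR.ops TR.ops
lemmas sub = TB.sub BR.sub TR.sub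

lemma bimod_BT: "bimod B T (regular B)" and bimod_TB: "bimod T B (regular B)"
  and bimod_RB: "bimod R B (regular R)" and bimod_BR: "bimod B R (regular R)"
  by (auto intro!: bimod_regular ring_ext_refl TB.ext BR.ext ring_ext_TR BR.C.ring_axioms TB.C.ring_axioms)

text \<open>\<open>II\<close> abbreviates Ind Ind and \<open>RR\<close> Res Res; both are tensored
  over the middle ring, in opposite order.\<close>

sublocale II: tensor_pair R B T "regular R" "regular B"
  using bimod_RB bimod_BT by (rule tensor_pair.intro)

sublocale RR: tensor_pair T B R "regular B" "regular R"
  using bimod_TB bimod_BR by (rule tensor_pair.intro)

lemma bimod_IndInd: "bimod R T (IndInd B R)"
  unfolding IndInd_def Ind_def by (rule II.bimod_MN)

lemma bimod_ResRes: "bimod T R (ResRes B R)"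
  unfolding ResRes_def Res_def by (rule RR.bimod_MN)

lemma one_closed: "\<one>\<^bsub>R\<^esub> \<in> carrier B"
  using TB.C.one_closed by (simp add: ops)

text \<open>Elements of \<open>B\<close> cross the tensor sign, so pure tensors have a normal form
  with 1 in the factor \<open>B\<close>. This one and \<open>RR_collapse\<close> express
  \<open>R \<otimes> B = R\<close> and \<open>B \<otimes> R = R\<close> over
  \<open>B\<close>.\<close>

lemma II_collapse: "\<lbrakk>f \<in> carrier R; g \<in> carrier B\<rbrakk> \<Longrightarrow> II.pure f g = II.pure (f \<otimes>\<^bsub>R\<^esub> g) \<one>\<^bsub>R\<^esub>"
  using II.pure_balanced[of f g "\<one>\<^bsub>B\<^esub>"] one_closed by (simp add: ops sub)

lemma RR_collapse: "\<lbrakk>g \<in> carrier B; f \<in> carrier R\<rbrakk> \<Longrightarrow> RR.pure g f = RR.pure \<one>\<^bsub>R\<^esub> (g \<otimes>\<^bsub>R\<^esub> f)"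
  using RR.pure_balanced[of "\<one>\<^bsub>B\<^esub>" g f] one_closed by (simp add: ops sub)

lemma
  shows bimap_ind_res_unit: "bimap T T (regular T) (tensor R (ResRes B R) (IndInd B R)) (ind_res_unit B R)"
    and ind_res_unit_one: "ind_res_unit B R \<one>\<^bsub>T\<^esub> =
      pure_tensor R (ResRes B R) (IndInd B R) (RR.pure \<one>\<^bsub>R\<^esub> \<one>\<^bsub>R\<^esub>) (II.pure \<one>\<^bsub>R\<^esub> \<one>\<^bsub>R\<^esub>)"
proof -
  note bimods = bimod_RB bimod_BT bimod_BR bimod_TB
  note bimaps = BR.bimap_incl_unit[unfolded Ind_def Res_def] TB.bimap_incl_unit[unfolded Ind_def Res_def]
  show "bimap T T (regular T) (tensor R (ResRes B R) (IndInd B R)) (ind_res_unit B R)"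
    unfolding ind_res_unit_def IndInd_def ResRes_def Ind_def Res_def
    by (rule bimap_comp_unit[OF TB.C.ring_axioms bimods bimaps])
  interpret X: tensor_pair T R T RR.MN II.MN
    using RR.bimod_MN II.bimod_MN by (rule tensor_pair.intro)
  have c: "X.pure (RR.pure \<one>\<^bsub>R\<^esub> \<one>\<^bsub>R\<^esub>) (II.pure \<one>\<^bsub>R\<^esub> \<one>\<^bsub>R\<^esub>) \<in> carrier X.MN"
    using TB.C.one_closed by (intro X.pure_closed RR.pure_closed II.pure_closed) (simp_all add: ops)
  \<comment> \<open>One-element index sets turn the single pure tensor into an instance of the
    general sum formula.\<close>
  have "ind_res_unit B R \<one>\<^bsub>T\<^esub> = (\<Oplus>\<^bsub>X.MN\<^esub> i \<in> {()}. \<Oplus>\<^bsub>X.MN\<^esub> j \<in> {()}.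
      X.pure (RR.pure \<one>\<^bsub>B\<^esub> \<one>\<^bsub>R\<^esub>) (II.pure \<one>\<^bsub>R\<^esub> \<one>\<^bsub>B\<^esub>))"
    unfolding ind_res_unit_def Ind_def Res_def
  proof (rule comp_unit_finsum[OF TB.C.ring_axioms bimods bimaps(1)])
    show "incl_unit B \<one>\<^bsub>T\<^esub> = (\<Oplus>\<^bsub>TB.RI.MN\<^esub> i \<in> {()}. TB.RI.pure \<one>\<^bsub>B\<^esub> \<one>\<^bsub>B\<^esub>)"
      using TB.RI.pure_closed[of "\<one>\<^bsub>B\<^esub>" "\<one>\<^bsub>B\<^esub>"]
      by (simp add: incl_unit_def Ind_def Res_def TB.ops TB.RI.MN.finsum_insert)
    show "incl_unit R \<one>\<^bsub>B\<^esub> = (\<Oplus>\<^bsub>BR.RI.MN\<^esub> i \<in> {()}. BR.RI.pure \<one>\<^bsub>R\<^esub> \<one>\<^bsub>R\<^esub>)"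
      using BR.RI.pure_closed[of "\<one>\<^bsub>R\<^esub>" "\<one>\<^bsub>R\<^esub>"]
      by (simp add: incl_unit_def Ind_def Res_def BR.ops BR.RI.MN.finsum_insert)
  qed auto
  then show "ind_res_unit B R \<one>\<^bsub>T\<^esub> =
      pure_tensor R (ResRes B R) (IndInd B R) (RR.pure \<one>\<^bsub>R\<^esub> \<one>\<^bsub>R\<^esub>) (II.pure \<one>\<^bsub>R\<^esub> \<one>\<^bsub>R\<^esub>)"
    using c by (simp add: ops X.MN.finsum_insert IndInd_def ResRes_def Ind_def Res_def)
qed

lemma
  shows bimap_ind_res_counit: "bimap R R (tensor T (IndInd B R) (ResRes B R)) (regular R) (ind_res_counit T B R)"
    and ind_res_counit_pure: "\<lbrakk>x \<in> carrier R; y \<in> carrier B; z \<in> carrier B; w \<in> carrier R\<rbrakk> \<Longrightarrow>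
      ind_res_counit T B R (pure_tensor T (IndInd B R) (ResRes B R) (II.pure x y) (RR.pure z w)) =
      x \<otimes>\<^bsub>R\<^esub> (y \<otimes>\<^bsub>R\<^esub> z \<otimes>\<^bsub>R\<^esub> w)"
proof -
  note bimods = bimod_RB bimod_BT bimod_BR bimod_TB
  note bimaps = BR.bimap_mult_counit[unfolded Ind_def Res_def] TB.bimap_mult_counit[unfolded Ind_def Res_def]
  show "bimap R R (tensor T (IndInd B R) (ResRes B R)) (regular R) (ind_res_counit T B R)"
    unfolding ind_res_counit_def IndInd_def ResRes_def Ind_def Res_def
    by (rule bimap_comp_counit[OF TB.C.ring_axioms bimods bimaps])
  assume xyzw: "x \<in> carrier R" "y \<in> carrier B" "z \<in> carrier B" "w \<in> carrier R"
  then show "ind_res_counit T B R (pure_tensor T (IndInd B R) (ResRes B R) (II.pure x y) (RR.pure z w)) =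
      x \<otimes>\<^bsub>R\<^esub> (y \<otimes>\<^bsub>R\<^esub> z \<otimes>\<^bsub>R\<^esub> w)"
    unfolding ind_res_counit_def IndInd_def ResRes_def Ind_def Res_def
    using comp_counit_pure[OF TB.C.ring_axioms bimods bimaps, of x y z w]
      TB.mult_counit_pure[unfolded Ind_def Res_def, of y z]
      BR.mult_counit_pure[unfolded Ind_def Res_def, of x "y \<otimes>\<^bsub>R\<^esub> z \<otimes>\<^bsub>R\<^esub> w"]
    by (simp add: ops sub)
qed

end

section \<open>Composite traces and dual bases in a Frobenius tower\<close>

locale frobenius_tower = tower T B R + TB: frobenius T B \<delta>B + BR: frobenius B R \<delta>R
  for T :: "('a, 'c) ring_scheme" and B :: "('a, 'd) ring_scheme" and R :: "('a, 'e) ring_scheme"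
    and \<delta>B \<delta>R :: "'a \<Rightarrow> 'a"
begin

text \<open>The composite counit yields \<open>\<delta>B (a \<delta>R (f g))\<close>, and linearity
  of \<open>\<delta>R\<close> over \<open>B\<close> takes \<open>a\<close> inside. The last factor
  has the form \<open>g \<otimes> 1\<close>, in which the induction map delivers its values.\<close>

lemma
  shows bimap_res_ind_counit:
      "bimap T T (tensor R (ResRes B R) (IndInd B R)) (regular T) (res_ind_counit T B R \<delta>R \<delta>B)"
    and res_ind_counit_pure: "\<lbrakk>a \<in> carrier B; f \<in> carrier R; g \<in> carrier R\<rbrakk> \<Longrightarrow>
      res_ind_counit T B R \<delta>R \<delta>B
        (pure_tensor R (ResRes B R) (IndInd B R) (RR.pure a f) (II.pure g \<one>\<^bsub>R\<^esub>)) =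
      \<delta>B (\<delta>R (a \<otimes>\<^bsub>R\<^esub> f \<otimes>\<^bsub>R\<^esub> g))"
proof -
  note bimods = bimod_TB bimod_BR bimod_BT bimod_RB
  note bimaps = TB.bimap_trace_counit[unfolded Ind_def Res_def] BR.bimap_trace_counit[unfolded Ind_def Res_def]
  show "bimap T T (tensor R (ResRes B R) (IndInd B R)) (regular T) (res_ind_counit T B R \<delta>R \<delta>B)"
    unfolding res_ind_counit_def IndInd_def ResRes_def Ind_def Res_def
    by (rule bimap_comp_counit[OF TB.C.ring_axioms bimods bimaps])
  assume afg: "a \<in> carrier B" "f \<in> carrier R" "g \<in> carrier R"
  have "\<delta>R (f \<otimes>\<^bsub>R\<^esub> g) \<otimes>\<^bsub>B\<^esub> \<one>\<^bsub>B\<^esub> = \<delta>R (f \<otimes>\<^bsub>R\<^esub> g)"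
    using afg by (intro TB.C.r_one) simp
  then show "res_ind_counit T B R \<delta>R \<delta>B
        (pure_tensor R (ResRes B R) (IndInd B R) (RR.pure a f) (II.pure g \<one>\<^bsub>R\<^esub>)) =
      \<delta>B (\<delta>R (a \<otimes>\<^bsub>R\<^esub> f \<otimes>\<^bsub>R\<^esub> g))"
    unfolding res_ind_counit_def IndInd_def ResRes_def Ind_def Res_def
    using afg one_closed comp_counit_pure[OF TB.C.ring_axioms bimods bimaps, of a f g "\<one>\<^bsub>B\<^esub>"]
      BR.trace_counit_pure[unfolded Ind_def Res_def, of f g]
      TB.trace_counit_pure[unfolded Ind_def Res_def, of a "\<delta>R (f \<otimes>\<^bsub>R\<^esub> g)"]
    by (simp add: ops sub BR.C.m_assoc flip: BR.\<delta>_left)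
qed

text \<open>The products \<open>x\<^sub>i u\<^sub>j\<close> and \<open>v\<^sub>j y\<^sub>i\<close>
  are dual bases of \<open>R\<close> over \<open>T\<close> for the composite trace; here they appear
  in factored form, with the bases of \<open>B\<close> over \<open>T\<close> nested inside.\<close>

lemma
  shows bimap_res_ind_unit:
      "bimap R R (regular R) (tensor T (IndInd B R) (ResRes B R)) (res_ind_unit T B R \<delta>R \<delta>B)"
    and res_ind_unit_one: "\<lbrakk>dual_bases B R \<delta>R n x y; dual_bases T B \<delta>B m u v\<rbrakk> \<Longrightarrow>
      res_ind_unit T B R \<delta>R \<delta>B \<one>\<^bsub>R\<^esub> =
      (\<Oplus>\<^bsub>tensor T (IndInd B R) (ResRes B R)\<^esub> i \<in> {..<n}. \<Oplus>\<^bsub>tensor T (IndInd B R) (ResRes B R)\<^esub> j \<in> {..<m}.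
        pure_tensor T (IndInd B R) (ResRes B R) (II.pure (x i) (u j)) (RR.pure (v j) (y i)))"
proof -
  note bimods = bimod_TB bimod_BR bimod_BT bimod_RB
  note bimaps = TB.bimap_comult_unit[unfolded Ind_def Res_def] BR.bimap_comult_unit[unfolded Ind_def Res_def]
  show "bimap R R (regular R) (tensor T (IndInd B R) (ResRes B R)) (res_ind_unit T B R \<delta>R \<delta>B)"
    unfolding res_ind_unit_def IndInd_def ResRes_def Ind_def Res_def
    by (rule bimap_comp_unit[OF TB.C.ring_axioms bimods bimaps])
  assume xy: "dual_bases B R \<delta>R n x y" and uv: "dual_bases T B \<delta>B m u v"
  show "res_ind_unit T B R \<delta>R \<delta>B \<one>\<^bsub>R\<^esub> =
      (\<Oplus>\<^bsub>tensor T (IndInd B R) (ResRes B R)\<^esub> i \<in> {..<n}. \<Oplus>\<^bsub>tensor T (IndInd B R) (ResRes B R)\<^esub> j \<in> {..<m}.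
        pure_tensor T (IndInd B R) (ResRes B R) (II.pure (x i) (u j)) (RR.pure (v j) (y i)))"
    unfolding res_ind_unit_def IndInd_def ResRes_def Ind_def Res_def
  proof (rule comp_unit_finsum[OF TB.C.ring_axioms bimods bimaps(1)])
    show "comult_unit B R \<delta>R \<one>\<^bsub>R\<^esub> = (\<Oplus>\<^bsub>BR.IR.MN\<^esub> i \<in> {..<n}. BR.IR.pure (x i) (y i))"
      using BR.comult_unit_one[OF xy] by (simp add: Ind_def Res_def)
    show "comult_unit T B \<delta>B \<one>\<^bsub>B\<^esub> = (\<Oplus>\<^bsub>TB.IR.MN\<^esub> j \<in> {..<m}. TB.IR.pure (u j) (v j))"
      using TB.comult_unit_one[OF uv] by (simp add: Ind_def Res_def)
  qed (auto simp: BR.dual_bases_closed[OF xy] TB.dual_bases_closed[OF uv])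
qed

text \<open>
  The telescoping behind cyclicity: \<open>\<Sum>\<^sub>j \<delta>\<^sub>B(c u\<^sub>j) v\<^sub>j = c\<close> with \<open>c = \<delta>\<^sub>R(z x\<^sub>i)\<close>, and then
  \<open>\<Sum>\<^sub>i \<delta>\<^sub>R(z x\<^sub>i) y\<^sub>i = z\<close>.
\<close>

lemma dual_bases_tower_expand:
  assumes xy: "dual_bases B R \<delta>R n x y" and uv: "dual_bases T B \<delta>B m u v" and z: "z \<in> carrier R"
  shows "(\<Oplus>\<^bsub>RR.MN\<^esub> i \<in> {..<n}. \<Oplus>\<^bsub>RR.MN\<^esub> j \<in> {..<m}.
      \<delta>B (\<delta>R (z \<otimes>\<^bsub>R\<^esub> (x i \<otimes>\<^bsub>R\<^esub> u j))) \<odot>\<^bsub>RR.MN\<^esub> RR.pure (v j) (y i)) = RR.pure \<one>\<^bsub>R\<^esub> z"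
proof -
  note closed = BR.dual_bases_closed[OF xy] TB.dual_bases_closed[OF uv] z
  have scal: "\<delta>R (z \<otimes>\<^bsub>R\<^esub> (x i \<otimes>\<^bsub>R\<^esub> u j)) = \<delta>R (z \<otimes>\<^bsub>R\<^esub> x i) \<otimes>\<^bsub>B\<^esub> u j" if "i < n" "j < m" for i j
    using that by (simp add: closed sub BR.\<delta>_right ops flip: BR.C.m_assoc)
  have "(\<Oplus>\<^bsub>RR.MN\<^esub> i \<in> {..<n}. \<Oplus>\<^bsub>RR.MN\<^esub> j \<in> {..<m}.
      \<delta>B (\<delta>R (z \<otimes>\<^bsub>R\<^esub> (x i \<otimes>\<^bsub>R\<^esub> u j))) \<odot>\<^bsub>RR.MN\<^esub> RR.pure (v j) (y i)) =
    (\<Oplus>\<^bsub>RR.MN\<^esub> i \<in> {..<n}. RR.pure \<one>\<^bsub>R\<^esub> (\<delta>R (z \<otimes>\<^bsub>R\<^esub> x i) \<otimes>\<^bsub>R\<^esub> y i))"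
  proof (intro RR.MN.finsum_cong' refl)
    fix i assume "i \<in> {..<n}"
    then have i: "i < n" by simp
    let ?c = "\<delta>R (z \<otimes>\<^bsub>R\<^esub> x i)"
    have c: "?c \<in> carrier B" using i by (simp add: closed)
    have cu: "\<delta>B (?c \<otimes>\<^bsub>B\<^esub> u j) \<in> carrier T" if "j < m" for j
      using that c closed by (intro TB.\<delta>_closed TB.C.m_closed)
    have v: "\<delta>B (?c \<otimes>\<^bsub>B\<^esub> u j) \<otimes>\<^bsub>B\<^esub> v j \<in> carrier B" if "j < m" for j
      using that closed by (intro TB.C.m_closed TB.sub[OF cu])
    have add: "additive B RR.MN (\<lambda>b. RR.pure b (y i))"
      using i RR.pure_closed RR.pure_add_left by (intro additiveI) (simp_all add: closed)
    have "(\<Oplus>\<^bsub>RR.MN\<^esub> j \<in> {..<m}. \<delta>B (\<delta>R (z \<otimes>\<^bsub>R\<^esub> (x i \<otimes>\<^bsub>R\<^esub> u j))) \<odot>\<^bsub>RR.MN\<^esub> RR.pure (v j) (y i)) =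
        (\<Oplus>\<^bsub>RR.MN\<^esub> j \<in> {..<m}. RR.pure (\<delta>B (?c \<otimes>\<^bsub>B\<^esub> u j) \<otimes>\<^bsub>B\<^esub> v j) (y i))"
    proof (intro RR.MN.finsum_cong' refl)
      fix j assume "j \<in> {..<m}"
      then show "\<delta>B (\<delta>R (z \<otimes>\<^bsub>R\<^esub> (x i \<otimes>\<^bsub>R\<^esub> u j))) \<odot>\<^bsub>RR.MN\<^esub> RR.pure (v j) (y i) =
          RR.pure (\<delta>B (?c \<otimes>\<^bsub>B\<^esub> u j) \<otimes>\<^bsub>B\<^esub> v j) (y i)"
        using i RR.smult_pure[OF cu, of j "v j" "y i"] by (simp only: scal lessThan_iff) (simp add: closed)
    qed (use i v in \<open>auto simp: closed intro!: RR.pure_closed\<close>)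
    also have "\<dots> = RR.pure (\<Oplus>\<^bsub>B\<^esub> j \<in> {..<m}. \<delta>B (?c \<otimes>\<^bsub>B\<^esub> u j) \<otimes>\<^bsub>B\<^esub> v j) (y i)"
      by (rule additive_finsum[OF add TB.C.abelian_group_axioms RR.abelian_MN, symmetric])
        (use v in auto)
    also have "\<dots> = RR.pure ?c (y i)"
      using TB.dual_bases_expand[OF uv c] by simp
    \<comment> \<open>The coefficient lies in \<open>B\<close>, so it crosses the tensor sign and
      joins \<open>y\<^sub>i\<close> to form a term of the outer expansion.\<close>
    also have "\<dots> = RR.pure \<one>\<^bsub>R\<^esub> (?c \<otimes>\<^bsub>R\<^esub> y i)"
      using i c by (intro RR_collapse) (simp_all add: closed)
    finally show "(\<Oplus>\<^bsub>RR.MN\<^esub> j \<in> {..<m}. \<delta>B (\<delta>R (z \<otimes>\<^bsub>R\<^esub> (x i \<otimes>\<^bsub>R\<^esub> u j))) \<odot>\<^bsub>RR.MN\<^esub> RR.pure (v j) (y i)) =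
        RR.pure \<one>\<^bsub>R\<^esub> (?c \<otimes>\<^bsub>R\<^esub> y i)" .
  qed (auto simp: closed one_closed BR.sub intro!: RR.pure_closed)
  also have "\<dots> = RR.pure \<one>\<^bsub>R\<^esub> (\<Oplus>\<^bsub>R\<^esub> i \<in> {..<n}. \<delta>R (z \<otimes>\<^bsub>R\<^esub> x i) \<otimes>\<^bsub>R\<^esub> y i)"
  proof (rule additive_finsum[OF _ BR.C.abelian_group_axioms RR.abelian_MN, symmetric])
    show "additive R RR.MN (RR.pure \<one>\<^bsub>R\<^esub>)"
      using RR.pure_closed[of "\<one>\<^bsub>R\<^esub>"] RR.pure_add_right[of "\<one>\<^bsub>R\<^esub>"] one_closed by (intro additiveI) simp_all
  qed (auto simp: closed BR.sub intro!: BR.C.m_closed)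
  also have "\<dots> = RR.pure \<one>\<^bsub>R\<^esub> z"
    using BR.dual_bases_expand[OF xy z] by simp
  finally show ?thesis .
qed

end

section \<open>Squares of extensions: the induction map and the left mate\<close>

text \<open>The data are symmetric in the two middle rings, so the locale can be interpreted inside
  itself with \<open>B\<close> and \<open>B'\<close> exchanged.\<close>

locale tower_square = b: tower T B R + r: tower T B' R
  for T :: "('a, 'c) ring_scheme" and B :: "('a, 'd) ring_scheme"
    and B' :: "('a, 'f) ring_scheme" and R :: "('a, 'e) ring_scheme"
begin

lemmas one_closed = b.one_closed r.one_closed

lemma ResRes: "ResRes B R = b.RR.MN" "ResRes B' R = r.RR.MN"
  by (simp_all add: ResRes_def Res_def)

lemma
  shows bimap_induction_map: "bimap R T (IndInd B R) (IndInd B' R) (induction_map B B' R)"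
    and induction_map_pure: "\<lbrakk>f \<in> carrier R; g \<in> carrier B\<rbrakk> \<Longrightarrow>
      induction_map B B' R (b.II.pure f g) = r.II.pure (f \<otimes>\<^bsub>R\<^esub> g) \<one>\<^bsub>R\<^esub>"
proof -
  have bal: "balanced B (regular R) (regular B) r.II.MN (\<lambda>f g. r.II.pure (f \<otimes>\<^bsub>R\<^esub> g) \<one>\<^bsub>R\<^esub>)"
    using r.II.pure_closed[of _ "\<one>\<^bsub>R\<^esub>"] r.II.pure_add_left[of _ _ "\<one>\<^bsub>R\<^esub>"] one_closed
    by (intro balancedI)
      (simp_all add: b.ops b.sub b.BR.C.l_distr b.BR.C.r_distr b.BR.C.m_assoc)
  \<comment> \<open>Right linearity over \<open>T\<close>: an element of \<open>T\<close> also lies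
    in \<open>B'\<close>, so it can be moved from the first factor across the tensor sign over
    \<open>B'\<close>.\<close>
  have rT: "r.II.pure (f \<otimes>\<^bsub>R\<^esub> (g \<otimes>\<^bsub>R\<^esub> t)) \<one>\<^bsub>R\<^esub> = r.II.pure (f \<otimes>\<^bsub>R\<^esub> g) t"
    if "f \<in> carrier R" "g \<in> carrier B" "t \<in> carrier T" for f g t
    using that r.II_collapse[of "f \<otimes>\<^bsub>R\<^esub> g" t] by (simp add: b.sub r.sub b.BR.C.m_assoc)
  have rT': "t \<in> carrier T \<Longrightarrow> \<one>\<^bsub>R\<^esub> \<otimes>\<^bsub>B'\<^esub> t = t" for t
    by (simp add: r.ops r.sub)
  show "bimap R T (IndInd B R) (IndInd B' R) (induction_map B B' R)"
    unfolding induction_map_def IndInd_def Ind_def r.BR.ops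
    by (rule b.II.bimap_tensor_lift[OF r.II.bimod_MN bal])
      (use one_closed in \<open>simp_all add: b.ops rT rT' b.sub b.BR.C.m_assoc r.II.smult_pure r.II.ract_pure\<close>)
  show "induction_map B B' R (b.II.pure f g) = r.II.pure (f \<otimes>\<^bsub>R\<^esub> g) \<one>\<^bsub>R\<^esub>"
    if "f \<in> carrier R" "g \<in> carrier B"
    unfolding induction_map_def IndInd_def Ind_def r.BR.ops
    using that by (intro b.II.tensor_lift_pure[OF r.II.abelian_MN bal]) simp_all
qed

abbreviation "left_mate \<equiv> mate_left R T (IndInd B R) (ResRes B R) (IndInd B' R) (ResRes B' R)
  (ind_res_unit B R) (ind_res_counit T B' R) (induction_map B B' R)"

text \<open>The unit contributes only ones, the induction map preserves
  \<open>1 \<otimes> 1\<close>, and the counit multiplies \<open>a\<close> and \<open>f\<close>. The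
  product then acts from the right on the second factor of \<open>1 \<otimes> 1\<close>; no trace is
  evaluated.\<close>

lemma
  shows bimap_left_mate: "bimap T R (ResRes B' R) (ResRes B R) left_mate"
    and left_mate_pure: "\<lbrakk>a \<in> carrier B'; f \<in> carrier R\<rbrakk> \<Longrightarrow>
      left_mate (r.RR.pure a f) = b.RR.pure \<one>\<^bsub>R\<^esub> (a \<otimes>\<^bsub>R\<^esub> f)"
proof -
  note bimaps = b.BR.C.ring_axioms b.TB.A.ring_axioms b.bimod_IndInd b.bimod_ResRes r.bimod_IndInd r.bimod_ResRes
    b.bimap_ind_res_unit r.bimap_ind_res_counit bimap_induction_map
  show "bimap T R (ResRes B' R) (ResRes B R) left_mate"
    by (rule bimap_mate_left[OF bimaps])
  assume af: "a \<in> carrier B'" "f \<in> carrier R"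
  have "left_mate (r.RR.pure a f) = ract (ResRes B R) (b.RR.pure \<one>\<^bsub>R\<^esub> \<one>\<^bsub>R\<^esub>)
      (ind_res_counit T B' R (pure_tensor T (IndInd B' R) (ResRes B' R)
        (induction_map B B' R (b.II.pure \<one>\<^bsub>R\<^esub> \<one>\<^bsub>R\<^esub>)) (r.RR.pure a f)))"
    by (rule mate_left_eq[OF bimaps _ _ _ b.ind_res_unit_one])
      (use af one_closed in \<open>auto simp: ResRes_def IndInd_def Res_def Ind_def intro!: r.RR.pure_closed b.RR.pure_closed b.II.pure_closed\<close>)
  also have "\<dots> = b.RR.pure \<one>\<^bsub>R\<^esub> (a \<otimes>\<^bsub>R\<^esub> f)"
    using af one_closed
    by (simp add: induction_map_pure r.ind_res_counit_pure r.sub)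
      (simp add: ResRes_def Res_def b.RR.ract_pure r.sub)
  finally show "left_mate (r.RR.pure a f) = b.RR.pure \<one>\<^bsub>R\<^esub> (a \<otimes>\<^bsub>R\<^esub> f)" .
qed

interpretation swap: tower_square T B' B R
  by (intro tower_square.intro b.tower_axioms r.tower_axioms)

text \<open>There and back, \<open>f \<otimes> g\<close> becomes \<open>f g \<otimes> 1\<close>,
  which is \<open>f \<otimes> g\<close> again by \<open>II_collapse\<close>. The next lemma argues
  the same way with \<open>RR_collapse\<close>.\<close>

lemma induction_map_iso: "induction_map B B' R \<in> bimodule_iso R T (IndInd B R) (IndInd B' R)"
proof -
  have "bij_betw (induction_map B B' R) (carrier b.II.MN) (carrier r.II.MN)"
    by (rule b.II.bij_betw_tensorI[OF r.II.tensor_pair_axioms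
          bimapD(3)[OF bimap_induction_map, unfolded IndInd_def Ind_def]
          bimapD(3)[OF swap.bimap_induction_map, unfolded IndInd_def Ind_def]])
      (use one_closed in \<open>simp_all add: induction_map_pure swap.induction_map_pure b.sub r.sub
        b.II_collapse[symmetric] r.II_collapse[symmetric]\<close>)
  then show ?thesis
    using bimap_induction_map by (simp add: bimodule_iso_def bimap_def IndInd_def Ind_def)
qed

lemma left_mate_iso: "left_mate \<in> bimodule_iso T R (ResRes B' R) (ResRes B R)"
proof -
  have "additive r.RR.MN b.RR.MN left_mate" "additive b.RR.MN r.RR.MN swap.left_mate"
    using bimapD(3)[OF bimap_left_mate] bimapD(3)[OF swap.bimap_left_mate] by (simp_all only: ResRes)
  then have "bij_betw left_mate (carrier r.RR.MN) (carrier b.RR.MN)"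
    by (rule r.RR.bij_betw_tensorI[OF b.RR.tensor_pair_axioms])
      (use one_closed in \<open>simp_all add: left_mate_pure swap.left_mate_pure b.sub r.sub
        b.RR_collapse[symmetric] r.RR_collapse[symmetric]\<close>)
  then show ?thesis
    using bimap_left_mate by (simp add: bimodule_iso_def bimap_def ResRes_def Res_def)
qed

end

section \<open>Compatible squares: the right mate and cyclicity\<close>

text \<open>A lower-case index marks the trace from \<open>R\<close> to a middle ring, an upper-case
  one the trace from that middle ring to \<open>T\<close>. The equation is oriented to rewrite the
  trace through \<open>B'\<close> into the one through \<open>B\<close>.\<close>

locale frobenius_square = b: frobenius_tower T B R \<delta>B \<delta>b + r: frobenius_tower T B' R \<delta>B' \<delta>r
  for T :: "('a, 'c) ring_scheme" and B :: "('a, 'd) ring_scheme"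
    and B' :: "('a, 'f) ring_scheme" and R :: "('a, 'e) ring_scheme" and \<delta>B \<delta>b \<delta>B' \<delta>r :: "'a \<Rightarrow> 'a" +
  assumes compat: "f \<in> carrier R \<Longrightarrow> \<delta>B' (\<delta>r f) = \<delta>B (\<delta>b f)"
begin

sublocale tower_square T B B' R
  by (intro tower_square.intro b.tower_axioms r.tower_axioms)

abbreviation "right_mate \<equiv> mate_right R T (IndInd B R) (ResRes B R) (IndInd B' R) (ResRes B' R)
  (res_ind_unit T B R \<delta>b \<delta>B) (res_ind_counit T B' R \<delta>r \<delta>B') (induction_map B B' R)"

lemma
  shows bimap_right_mate: "bimap T R (ResRes B' R) (ResRes B R) right_mate"
    and right_mate_pure: "\<lbrakk>a \<in> carrier B'; f \<in> carrier R\<rbrakk> \<Longrightarrow>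
      right_mate (r.RR.pure a f) = b.RR.pure \<one>\<^bsub>R\<^esub> (a \<otimes>\<^bsub>R\<^esub> f)"
proof -
  note bimaps = b.BR.C.ring_axioms b.TB.A.ring_axioms b.bimod_IndInd b.bimod_ResRes r.bimod_IndInd r.bimod_ResRes
    b.bimap_res_ind_unit r.bimap_res_ind_counit bimap_induction_map
  show "bimap T R (ResRes B' R) (ResRes B R) right_mate"
    by (rule bimap_mate_right[OF bimaps])
  assume a: "a \<in> carrier B'" and f: "f \<in> carrier R"
  obtain n x y where xy: "dual_bases B R \<delta>b n x y" using b.BR.ex_dual_bases by blast
  obtain m u v where uv: "dual_bases T B \<delta>B m u v" using b.TB.ex_dual_bases by blast
  note closed = b.BR.dual_bases_closed[OF xy] b.TB.dual_bases_closed[OF uv]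
  \<comment> \<open>This is where the colours meet: the counit produces the trace through
    \<open>B'\<close>, while \<open>x\<close>, \<open>y\<close>, \<open>u\<close>, \<open>v\<close>
    are dual for the traces through \<open>B\<close>. \<open>compat\<close> exchanges the two and
    makes the tower expansion applicable.\<close>
  have scal: "res_ind_counit T B' R \<delta>r \<delta>B' (pure_tensor R (ResRes B' R) (IndInd B' R) (r.RR.pure a f)
      (induction_map B B' R (b.II.pure (x i) (u j)))) = \<delta>B (\<delta>b (a \<otimes>\<^bsub>R\<^esub> f \<otimes>\<^bsub>R\<^esub> (x i \<otimes>\<^bsub>R\<^esub> u j)))"
    if "i < n" "j < m" for i j
    using that a f
    by (simp add: induction_map_pure closed b.sub r.sub r.res_ind_counit_pure compat)
  have scal_closed: "\<delta>B (\<delta>b (a \<otimes>\<^bsub>R\<^esub> f \<otimes>\<^bsub>R\<^esub> (x i \<otimes>\<^bsub>R\<^esub> u j))) \<in> carrier T" if "i < n" "j < m" for i j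
    using that a f by (simp add: closed b.sub r.sub)
  have "right_mate (r.RR.pure a f) = (\<Oplus>\<^bsub>ResRes B R\<^esub> i \<in> {..<n}. \<Oplus>\<^bsub>ResRes B R\<^esub> j \<in> {..<m}.
      res_ind_counit T B' R \<delta>r \<delta>B' (pure_tensor R (ResRes B' R) (IndInd B' R) (r.RR.pure a f)
        (induction_map B B' R (b.II.pure (x i) (u j)))) \<odot>\<^bsub>ResRes B R\<^esub> b.RR.pure (v j) (y i))"
    by (rule mate_right_finsum[OF bimaps _ _ _ b.res_ind_unit_one[OF xy uv]])
      (use a f closed in \<open>auto simp: ResRes_def IndInd_def Res_def Ind_def
        intro!: r.RR.pure_closed b.RR.pure_closed b.II.pure_closed\<close>)
  also have "\<dots> = (\<Oplus>\<^bsub>b.RR.MN\<^esub> i \<in> {..<n}. \<Oplus>\<^bsub>b.RR.MN\<^esub> j \<in> {..<m}.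
      \<delta>B (\<delta>b (a \<otimes>\<^bsub>R\<^esub> f \<otimes>\<^bsub>R\<^esub> (x i \<otimes>\<^bsub>R\<^esub> u j))) \<odot>\<^bsub>b.RR.MN\<^esub> b.RR.pure (v j) (y i))"
    unfolding ResRes(1)
    by (intro b.RR.MN.finsum_cong' refl)
      (auto simp: scal closed intro!: b.RR.MN.finsum_closed b.RR.smult_closed scal_closed b.RR.pure_closed)
  also have "\<dots> = b.RR.pure \<one>\<^bsub>R\<^esub> (a \<otimes>\<^bsub>R\<^esub> f)"
    using a f by (intro b.dual_bases_tower_expand[OF xy uv]) (simp add: r.sub)
  finally show "right_mate (r.RR.pure a f) = b.RR.pure \<one>\<^bsub>R\<^esub> (a \<otimes>\<^bsub>R\<^esub> f)" .
qed

lemma mates_eq: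
  assumes "t \<in> carrier (ResRes B' R)"
  shows "left_mate t = right_mate t"
proof (rule r.RR.tensor_ext[where X = b.RR.MN and g = left_mate and h = right_mate])
  show "additive r.RR.MN b.RR.MN left_mate" "additive r.RR.MN b.RR.MN right_mate" "t \<in> carrier r.RR.MN"
    using bimapD(3)[OF bimap_left_mate] bimapD(3)[OF bimap_right_mate] assms by (simp_all only: ResRes)
qed (simp add: left_mate_pure right_mate_pure)

end

section \<open>Passage from algebra records to the abstract square\<close>

lemma algebra_extensionD:
  assumes "algebra_extension K A B"
  shows "cring A" "cring B" "ring_ext A B"
proof -
  interpret A: algebra K A using assms by (simp add: algebra_extension_def)
  interpret B: algebra K B using assms by (simp add: algebra_extension_def)
  show "cring A" "cring B" by (rule A.M_cring B.M_cring)+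
  have eq: "A = B\<lparr>carrier := carrier A\<rparr>" and sub: "carrier A \<subseteq> carrier B"
    using assms by (simp_all add: algebra_extension_def)
  have "ring.add A = ring.add B" "monoid.mult A = monoid.mult B" "\<zero>\<^bsub>A\<^esub> = \<zero>\<^bsub>B\<^esub>" "\<one>\<^bsub>A\<^esub> = \<one>\<^bsub>B\<^esub>"
    by (subst eq, simp)+
  then show "ring_ext A B"
    using sub cring.axioms(1)[OF A.M_cring] cring.axioms(1)[OF B.M_cring] by (simp add: ring_ext_def)
qed

lemma frobenius_extension_imp_frobenius:
  assumes "frobenius_extension K A B \<delta>"
  shows "frobenius A B \<delta>"
  using assms algebra_extensionD[of K A B]
  by (simp add: frobenius_def frobenius_axioms_def extension_def extension_axioms_def frobenius_extension_def)

theorem claim1p6: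
  fixes K :: "('k, 'c) ring_scheme"
    and R Rr Rb Rrb :: "('k, 'a, 'd) module_scheme"
    and \<delta>r \<delta>b \<delta>r_rb \<delta>b_rb :: "'a \<Rightarrow> 'a"
  assumes "compatible_frobenius_square K R Rr Rb Rrb \<delta>r \<delta>b \<delta>r_rb \<delta>b_rb"
  shows
    "let P = IndInd Rb R; P' = ResRes Rb R;
         Q = IndInd Rr R; Q' = ResRes Rr R;
         \<phi> = induction_map Rb Rr R;
         left = mate_left R Rrb P P' Q Q' (ind_res_unit Rb R) (ind_res_counit Rrb Rr R) \<phi>;
         right = mate_right R Rrb P P' Q Q'
                   (res_ind_unit Rrb Rb R \<delta>b \<delta>b_rb) (res_ind_counit Rrb Rr R \<delta>r \<delta>r_rb) \<phi>
     in \<phi> \<in> bimodule_iso R Rrb P Q \<and>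
        (\<forall>f \<in> carrier R.
           \<phi> (pure_tensor Rb (Ind R) (Ind Rb) f \<one>\<^bsub>Rb\<^esub>) = pure_tensor Rr (Ind R) (Ind Rr) f \<one>\<^bsub>Rr\<^esub>) \<and>
        (\<forall>t \<in> carrier Q'. left t = right t) \<and>
        left \<in> bimodule_iso Rrb R Q' P' \<and>
        (\<forall>f \<in> carrier R.
           left (pure_tensor Rr (Res Rr) (Res R) \<one>\<^bsub>Rr\<^esub> f) = pure_tensor Rb (Res Rb) (Res R) \<one>\<^bsub>Rb\<^esub> f)"
proof -
  have "frobenius Rr R \<delta>r" "frobenius Rb R \<delta>b" "frobenius Rrb Rr \<delta>r_rb" "frobenius Rrb Rb \<delta>b_rb"
    and compat: "\<And>f. f \<in> carrier R \<Longrightarrow> \<delta>r_rb (\<delta>r f) = \<delta>b_rb (\<delta>b f)"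
    using assms by (auto simp: compatible_frobenius_square_def intro: frobenius_extension_imp_frobenius)
  \<comment> \<open>The blue ring takes the place of \<open>B\<close> and the red one that of
    \<open>B'\<close>, since \<open>\<phi>\<close> goes from the blue induction to the red
    one.\<close>
  then interpret frobenius_square Rrb Rb Rr R \<delta>b_rb \<delta>b \<delta>r_rb \<delta>r
    by (simp add: frobenius_square_def frobenius_square_axioms_def frobenius_tower_def tower_def frobenius_def)
  \<comment> \<open>The locale results are phrased with the unit of \<open>R\<close>, the claim with
    the units of the middle rings; these are the same element.\<close>
  have \<phi>: "induction_map Rb Rr R (b.II.pure f \<one>\<^bsub>Rb\<^esub>) = r.II.pure f \<one>\<^bsub>Rr\<^esub>" if "f \<in> carrier R" for f
    using that one_closed induction_map_pure[of f "\<one>\<^bsub>R\<^esub>"] by (simp add: b.BR.ops r.BR.ops)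
  have left: "left_mate (r.RR.pure \<one>\<^bsub>Rr\<^esub> f) = b.RR.pure \<one>\<^bsub>Rb\<^esub> f" if "f \<in> carrier R" for f
    using that one_closed left_mate_pure[of "\<one>\<^bsub>R\<^esub>" f] by (simp add: b.BR.ops r.BR.ops)
  show ?thesis
    unfolding Let_def
    using induction_map_iso mates_eq left_mate_iso \<phi> left by (simp add: Ind_def Res_def)
qed

end
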